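(* For $p\ge1$, $k=1,\dots,2^{p-1}$: $$\xi_{p,k}=\lim_{N\to\infty}\sqrt{2N}\left(\sum_{l=1}^{p}\frac{1}{\alpha_{l,r(k,l)}}+\sum_{l=1}^{N-p}\frac{1}{\lambda_l(\alpha_{p,k})}-\lambda_N\right),$$ $$\rho_{p,k}=\prod_{l=1}^{p}\Big(1+\frac{1}{\alpha_{l,r(k,l)}^2}\Big)^{-1}\lim_{N\to\infty}\sqrt{2N}\prod_{l=1}^{N}\Big(1+\frac{1}{\lambda_l(\alpha_{p,k})^2}\Big)^{-1},$$ and $$\rho_0=\lim_{N\to\infty}\sqrt{2N}\prod_{l=1}^{N}\Big(1+\frac{1}{\lambda_l^2}\Big)^{-1}.$$
   Context: Let $(m_n)$ be the positive sequence with $m_0=1$, $(1+m_1+\cdots+m_n)m_n=1$ ($n\ge1$), $\mu$ the probability measure on $[0,1]$ with moments $m_n$, and $f$ the meromorphic extension to $\mathbb C$ of $f(z)=\int_0^1\frac{1-t^z}{1-t}\,d\mu(t)$ ($\Re z>0$). Its zeros are $\xi_0=0$ and, for each $p\ge1$, exactly $2^{p-1}$ simple zeros $\xi_{p,1}<\cdots<\xi_{p,2^{p-1}}$ in $]-p-1,-p[$; set $\rho_0=1/f'(0)$, $\rho_{p,k}=1/f'(\xi_{p,k})$. Let $\lambda_0=0$, $\lambda_{n+1}=1/m_n$. $\psi(z)=z-1/z$; $Y_n=\{z:\psi^{\circ n}(z)=0\}$ consists of $2^n$ reals $\alpha_{n,1}<\cdots<\alpha_{n,2^n}$. $r(k,l)$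 is the unique $x\in\{1,\dots,2^l\}$ with $x\equiv k\pmod{2^l}$. For real $s$, $\lambda_0(s)=s$ and $\lambda_{n+1}(s)=\tfrac12\big(\lambda_n(s)+\sqrt{\lambda_n(s)^2+4}\big)$. *)

theory Defs
  imports "HOL-Complex_Analysis.Complex_Analysis" "HOL-Probability.Probability"
begin

(* Partial sums S n = m_0 + ... + m_(n-1) and the sequence m:
   m_0 = 1 and, for n >= 1, m_n is the positive root of (S n + m_n) m_n = 1,
   i.e. of (1 + m_1 + ... + m_n) m_n = 1. *)
fun msum :: "nat \<Rightarrow> real" where
  "msum 0 = 0"
| "msum (Suc n) = msum n + (if n = 0 then 1 else (- msum n + sqrt (msum n ^ 2 + 4)) / 2)"

definition mseq :: "nat \<Rightarrow> real" where
  "mseq n = (if n = 0 then 1 else (- msum n + sqrt (msum n ^ 2 + 4)) / 2)"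

definition lam :: "nat \<Rightarrow> real" where
  "lam n = (if n = 0 then 0 else 1 / mseq (n - 1))"

fun lams :: "real \<Rightarrow> nat \<Rightarrow> real" where
  "lams s 0 = s"
| "lams s (Suc n) = (lams s n + sqrt (lams s n ^ 2 + 4)) / 2"

definition psi :: "real \<Rightarrow> real" where
  "psi z = z - 1 / z"

(* Y_n: the points z with psi^n(z) = 0 (z in the domain of psi^n, i.e. no
   intermediate iterate hits the pole 0) *)
definition Yset :: "nat \<Rightarrow> real set" where
  "Yset n = {z. (\<forall>j<n. (psi ^^ j) z \<noteq> 0) \<and> (psi ^^ n) z = 0}"

(* alpha_{n,j}, j = 1..2^n, the elements of Y_n in increasing order *)
definition alpha :: "nat \<Rightarrow> nat \<Rightarrow> real" where
  "alpha n j = sorted_list_of_set (Yset n) ! (j - 1)"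

definition rr :: "nat \<Rightarrow> nat \<Rightarrow> nat" where
  "rr k l = (THE x. x \<in> {1..2^l} \<and> x mod 2^l = k mod 2^l)"

(* integrand (1 - t^z)/(1 - t), continuously extended by z at t = 1 *)
definition kern :: "complex \<Rightarrow> real \<Rightarrow> complex" where
  "kern z t = (if t = 1 then z else (1 - complex_of_real t powr z) / (1 - complex_of_real t))"

definition is_zero :: "(complex \<Rightarrow> complex) \<Rightarrow> complex \<Rightarrow> bool" where
  "is_zero F z \<longleftrightarrow> \<not> is_pole F z \<and> F z = 0"

definition xi :: "(complex \<Rightarrow> complex) \<Rightarrow> nat \<Rightarrow> nat \<Rightarrow> real" where
  "xi F p k = sorted_list_of_set {x::real. - real p - 1 < x \<and> x < - real p \<and> is_zero F (complex_of_real x)} ! (k - 1)"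

end

theory Submission
  imports Defs
begin

text \<open>
  The function \<open>z \<mapsto> F (z + 1) - F z - 1 / F (z + 1)\<close> is holomorphic and bounded on the right
  half-plane, and the recursion for the moments makes it vanish at the positive integers. These
  nodes violate the Blaschke condition, so it is zero and \<open>\<psi> (F (z + 1)) = F z\<close> holds meromorphically.
  Since \<open>F\<close> maps \<open>]-1, 0[\<close> increasingly onto \<open>]-\<infinity>, 0[\<close>, a point \<open>x\<close> of \<open>]-p-1, -p[\<close> is a zero of \<open>F\<close>
  iff \<open>F (x + p) \<in> Y\<^sub>p\<close>; hence \<open>F (\<xi>\<^sub>p\<^sub>,\<^sub>k + p) = \<alpha>\<^sub>p\<^sub>,\<^sub>k\<close>, and the values of \<open>F\<close> at
  \<open>\<xi>\<^sub>p\<^sub>,\<^sub>k + l\<close> are the \<open>\<alpha>\<^sub>l\<^sub>,\<^sub>r\<^sub>(\<^sub>k\<^sub>,\<^sub>l\<^sub>)\<close> for \<open>l \<le> p\<close> and the \<open>\<lambda>\<^sub>l\<^sub>-\<^sub>p(\<alpha>\<^sub>p\<^sub>,\<^sub>k)\<close> beyond. The sums then telescope to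
  \<open>F (\<xi>\<^sub>p\<^sub>,\<^sub>k + N) - F N\<close>, and differentiating the functional equation turns the products into quotients
  \<open>F' (\<xi>\<^sub>p\<^sub>,\<^sub>k + N) / F' (\<xi>\<^sub>p\<^sub>,\<^sub>k)\<close>. Concavity of \<open>F\<close> on the positive axis squeezes its slopes near \<open>N\<close>
  between values \<open>1 / \<lambda>\<^sub>n\<close> with \<open>n - N\<close> bounded, all of them asymptotic to \<open>1 / \<surd>(2N)\<close>.
\<close>

section \<open>The preimages of 0 under the iterates of psi\<close>

text \<open>Increasing maps preserve ranks. Since \<open>alpha\<close> and \<open>xi\<close> are
  defined by position in a sorted list, this is how they are matched.\<close>

lemma sorted_list_of_set_image_strict_mono:
  fixes f :: "'a::linorder \<Rightarrow> 'b::linorder"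
  assumes "finite A" "strict_mono_on A f"
  shows "sorted_list_of_set (f ` A) = map f (sorted_list_of_set A)"
proof (rule sorted_distinct_set_unique)
  show "sorted (map f (sorted_list_of_set A))"
    unfolding sorted_map using assms
    by (intro sorted_wrt_mono_rel[OF _ sorted_sorted_list_of_set])
       (auto dest: strict_mono_on_leD)
  show "distinct (map f (sorted_list_of_set A))"
    using assms by (simp add: distinct_map strict_mono_on_imp_inj_on)
qed (use assms in auto)

lemma sorted_list_of_set_Un_less:
  fixes A B :: "'a::linorder set"
  assumes "finite A" "finite B" "\<And>a b. a \<in> A \<Longrightarrow> b \<in> B \<Longrightarrow> a < b"
  shows "sorted_list_of_set (A \<union> B) = sorted_list_of_set A @ sorted_list_of_set B"
proof (rule sorted_distinct_set_unique)
  show "sorted (sorted_list_of_set A @ sorted_list_of_set B)"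
    using assms by (auto simp: sorted_append intro: less_imp_le)
  show "distinct (sorted_list_of_set A @ sorted_list_of_set B)"
    using assms by (auto simp: distinct_append)
qed (use assms in auto)

section \<open>The two real inverse branches of \<open>psi\<close>\<close>

definition psi_inv_pos :: "real \<Rightarrow> real" where "psi_inv_pos y = (y + sqrt (y\<^sup>2 + 4)) / 2"
definition psi_inv_neg :: "real \<Rightarrow> real" where "psi_inv_neg y = (y - sqrt (y\<^sup>2 + 4)) / 2"

lemma sqrt_square_plus4_gt: "sqrt (y\<^sup>2 + 4) > \<bar>y\<bar>" for y :: real
  by (rule real_less_rsqrt) auto

lemma psi_inv_pos_pos: "psi_inv_pos y > 0" and psi_inv_neg_neg: "psi_inv_neg y < 0"
  using sqrt_square_plus4_gt[of y] by (auto simp: psi_inv_pos_def psi_inv_neg_def)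

text \<open>Multiplying by \<open>z\<close> gives z^2 - y z - 1 = 0, whose roots are the two
  branches. Their product is -1, so there is one root of each sign.\<close>

lemma psi_eq_iff:
  assumes "z \<noteq> 0"
  shows "psi z = y \<longleftrightarrow> z = psi_inv_pos y \<or> z = psi_inv_neg y"
proof -
  have sq: "sqrt (y\<^sup>2 + 4) ^ 2 = y\<^sup>2 + 4" by simp
  have "(z - psi_inv_pos y) * (z - psi_inv_neg y) = z\<^sup>2 - y * z + (y\<^sup>2 - sqrt (y\<^sup>2 + 4) ^ 2) / 4"
    unfolding psi_inv_pos_def psi_inv_neg_def by (simp add: field_simps power2_eq_square)
  also have "\<dots> = z * (psi z - y)"
    unfolding sq using assms by (simp add: psi_def field_simps power2_eq_square)
  finally show ?thesis using assms by auto
qed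

lemma psi_strict_mono_pos:
  assumes "0 < x" "x < y"
  shows "psi x < psi y"
proof -
  have "1 / y < 1 / x" using assms by (intro divide_strict_left_mono) auto
  then show ?thesis using assms by (simp add: psi_def)
qed

lemma psi_strict_mono_neg: "x < y \<Longrightarrow> y < 0 \<Longrightarrow> psi x < psi y"
  using psi_strict_mono_pos[of "-y" "-x"] by (simp add: psi_def)

lemma psi_psi_inv [simp]: "psi (psi_inv_pos y) = y" "psi (psi_inv_neg y) = y"
  using psi_eq_iff[of "psi_inv_pos y" y] psi_eq_iff[of "psi_inv_neg y" y]
        psi_inv_pos_pos[of y] psi_inv_neg_neg[of y] by auto

lemma strict_mono_psi_inv_pos: "strict_mono psi_inv_pos"
proof (rule strict_monoI)
  fix x y :: real assume "x < y"
  then show "psi_inv_pos x < psi_inv_pos y"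
    using psi_strict_mono_pos[of "psi_inv_pos y" "psi_inv_pos x"] psi_inv_pos_pos[of y]
    by (metis less_asym linorder_less_linear less_irrefl psi_psi_inv(1))
qed

lemma strict_mono_psi_inv_neg: "strict_mono psi_inv_neg"
proof (rule strict_monoI)
  fix x y :: real assume "x < y"
  then show "psi_inv_neg x < psi_inv_neg y"
    using psi_strict_mono_neg[of "psi_inv_neg y" "psi_inv_neg x"] psi_inv_neg_neg[of x]
    by (metis less_asym linorder_less_linear less_irrefl psi_psi_inv(2))
qed

lemma Yset_0: "Yset 0 = {0}"
  by (simp add: Yset_def)

text \<open>Peels off the first application of \<open>psi\<close>; \<open>z \<noteq> 0\<close> is
  the pole condition for \<open>j = 0\<close>.\<close>

lemma Yset_Suc_iff: "z \<in> Yset (Suc n) \<longleftrightarrow> z \<noteq> 0 \<and> psi z \<in> Yset n"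
  by (auto simp: Yset_def All_less_Suc2 funpow_swap1)

lemma Yset_Suc: "Yset (Suc n) = psi_inv_neg ` Yset n \<union> psi_inv_pos ` Yset n"
proof (intro set_eqI iffI)
  fix z assume "z \<in> Yset (Suc n)"
  then show "z \<in> psi_inv_neg ` Yset n \<union> psi_inv_pos ` Yset n"
    using psi_eq_iff[of z "psi z"] by (auto simp: Yset_Suc_iff)
next
  fix z assume "z \<in> psi_inv_neg ` Yset n \<union> psi_inv_pos ` Yset n"
  then show "z \<in> Yset (Suc n)"
    by (auto simp: Yset_Suc_iff psi_inv_pos_pos[THEN less_imp_neq, symmetric]
        psi_inv_neg_neg[THEN less_imp_neq])
qed

lemma finite_Yset: "finite (Yset n)"
  by (induction n) (auto simp: Yset_0 Yset_Suc)

text \<open>Both branches are increasing and all values of the negative one lie below those of the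
  positive one, so the sorted list is a concatenation of two images.\<close>

lemma sorted_list_of_Yset_Suc:
  "sorted_list_of_set (Yset (Suc n)) =
     map psi_inv_neg (sorted_list_of_set (Yset n)) @ map psi_inv_pos (sorted_list_of_set (Yset n))"
proof -
  have *: "strict_mono_on (Yset n) psi_inv_neg" "strict_mono_on (Yset n) psi_inv_pos"
    using strict_mono_psi_inv_neg strict_mono_psi_inv_pos
    by (auto simp: strict_mono_def strict_mono_on_def)
  show ?thesis
    unfolding Yset_Suc
    by (subst sorted_list_of_set_Un_less)
       (auto simp: finite_Yset sorted_list_of_set_image_strict_mono * 
             intro: less_trans[OF psi_inv_neg_neg psi_inv_pos_pos])
qed

lemma card_Yset: "card (Yset n) = 2 ^ n"
proof (induction n)
  case (Suc n)
  have "length (sorted_list_of_set (Yset (Suc n))) = 2 * card (Yset n)"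
    unfolding sorted_list_of_Yset_Suc by simp
  then show ?case using Suc by simp
qed (simp add: Yset_0)

section \<open>Ranks in \<open>Yset\<close> and residues of indices\<close>

lemma alpha_in_Yset: "k \<in> {1..2^n} \<Longrightarrow> alpha n k \<in> Yset n"
  using nth_mem[of "k - 1" "sorted_list_of_set (Yset n)"]
  by (auto simp: alpha_def finite_Yset card_Yset)

lemma alpha_Suc_lower:
  assumes "k \<in> {1..2^n}"
  shows "alpha (Suc n) k = psi_inv_neg (alpha n k)"
  using assms by (auto simp: alpha_def sorted_list_of_Yset_Suc nth_append finite_Yset card_Yset)

lemma alpha_Suc_upper:
  assumes "k \<in> {1..2^n}"
  shows "alpha (Suc n) (k + 2^n) = psi_inv_pos (alpha n k)"
  using assms by (auto simp: alpha_def sorted_list_of_Yset_Suc nth_append finite_Yset card_Yset)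

text \<open>Shifting by one turns the representative in {1..2^l} into an ordinary remainder.\<close>

lemma rr_eq:
  assumes "k \<ge> 1"
  shows "rr k l = Suc ((k - 1) mod 2 ^ l)"
  unfolding rr_def
proof (rule the_equality)
  show "Suc ((k - 1) mod 2 ^ l) \<in> {1..2 ^ l} \<and> Suc ((k - 1) mod 2 ^ l) mod 2 ^ l = k mod 2 ^ l"
    using assms by (auto simp: mod_Suc_eq Suc_le_eq)
next
  fix x :: nat assume x: "x \<in> {1..2 ^ l} \<and> x mod 2 ^ l = k mod 2 ^ l"
  then have "Suc (x - 1) mod 2 ^ l = Suc (k - 1) mod 2 ^ l"
    using assms by simp
  then have "(x - 1) mod 2 ^ l = (k - 1) mod 2 ^ l"
    by (metis mod_Suc nat.inject nat.simps(3))
  moreover have "(x - 1) mod 2 ^ l = x - 1" using x by auto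
  ultimately show "x = Suc ((k - 1) mod 2 ^ l)" using x by auto
qed

lemma rr_ge_1: "k \<ge> 1 \<Longrightarrow> rr k l \<in> {1..2^l}"
  by (simp add: rr_eq Suc_le_eq)

lemma rr_id:
  assumes "k \<in> {1..2^l}"
  shows "rr k l = k"
proof -
  have "k - 1 < 2 ^ l" using assms by auto
  then show ?thesis using assms by (simp add: rr_eq)
qed

lemma rr_rr: "k \<ge> 1 \<Longrightarrow> rr (rr k (Suc l)) l = rr k l"
  by (simp add: rr_eq mod_mod_cancel le_imp_power_dvd del: power_Suc)

text \<open>Both halves of the list at level \<open>Suc n\<close> are images of the list at level
  \<open>n\<close>, so applying \<open>psi\<close> drops the leading binary digit of
  \<open>k - 1\<close>.\<close>

lemma psi_alpha_Suc:
  assumes "k \<in> {1..2 ^ Suc n}"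
  shows "psi (alpha (Suc n) k) = alpha n (rr k n)"
proof (cases "k \<le> 2 ^ n")
  case True
  then show ?thesis using assms by (simp add: alpha_Suc_lower rr_id)
next
  case False
  define j where "j = k - 2 ^ n"
  have j: "k = j + 2 ^ n" "j \<in> {1..2 ^ n}" using False assms by (auto simp: j_def)
  have "rr k n = rr j n"
  proof -
    have "k - 1 = (j - 1) + 2 ^ n" using j by auto
    then have "(k - 1) mod 2 ^ n = (j - 1) mod 2 ^ n" by (metis mod_add_self2)
    then show ?thesis using j rr_eq[of k n] rr_eq[of j n] by simp
  qed
  then show ?thesis using j by (simp add: alpha_Suc_upper rr_id)
qed

lemma psi_alpha_rr:
  assumes "k \<ge> 1"
  shows "psi (alpha (Suc l) (rr k (Suc l))) = alpha l (rr k l)"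
  using psi_alpha_Suc[OF rr_ge_1[OF assms], of l] unfolding rr_rr[OF assms] .

lemma funpow_psi_alpha:
  assumes "k \<ge> 1" "j \<le> p"
  shows "(psi ^^ j) (alpha p (rr k p)) = alpha (p - j) (rr k (p - j))"
  using assms(2)
proof (induction j)
  case (Suc j)
  then have "p - j = Suc (p - Suc j)" by auto
  with Suc show ?case by (simp add: psi_alpha_rr[OF assms(1)])
qed simp

text \<open>The negative elements form the lower half of the list, which accounts for the range of
  \<open>k\<close> up to 2^(p-1).\<close>

lemma sorted_list_of_Yset_neg:
  assumes "p \<ge> 1"
  shows "sorted_list_of_set (Yset p \<inter> {..<0}) = take (2 ^ (p - 1)) (sorted_list_of_set (Yset p))"
proof -
  obtain n where p: "p = Suc n" using assms by (cases p) auto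
  have "Yset (Suc n) \<inter> {..<0} = psi_inv_neg ` Yset n"
    unfolding Yset_Suc using psi_inv_neg_neg psi_inv_pos_pos[THEN less_imp_le, THEN leD] by auto
  moreover have "strict_mono_on (Yset n) psi_inv_neg"
    using strict_mono_psi_inv_neg by (auto simp: strict_mono_def strict_mono_on_def)
  ultimately show ?thesis
    by (simp add: p sorted_list_of_Yset_Suc finite_Yset card_Yset sorted_list_of_set_image_strict_mono)
qed

section \<open>The sequence lam\<close>

lemma lams_Suc: "lams s (Suc n) = psi_inv_pos (lams s n)"
  by (simp add: psi_inv_pos_def)

lemma msum_Suc: "msum (Suc n) = msum n + mseq n"
  by (simp add: mseq_def)

lemma mseq_pos: "mseq n > 0"
  using sqrt_square_plus4_gt[of "msum n"] abs_ge_self[of "msum n"]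
  unfolding mseq_def by (auto simp del: abs_ge_self)

lemma msum_Suc_mult_mseq: "msum (Suc n) * mseq n = 1"
proof (cases "n = 0")
  case False
  have "sqrt (msum n ^ 2 + 4) ^ 2 = msum n ^ 2 + 4" by simp
  moreover have "msum (Suc n) * mseq n = (sqrt (msum n ^ 2 + 4) ^ 2 - msum n ^ 2) / 4"
    unfolding msum_Suc using False by (simp add: mseq_def field_simps power2_eq_square)
  ultimately show ?thesis by simp
qed (simp add: mseq_def)

lemma msum_Suc_pos: "msum (Suc n) > 0"
  using msum_Suc_mult_mseq[of n] mseq_pos[of n] zero_less_mult_pos2[of "msum (Suc n)" "mseq n"]
  by simp

declare msum.simps(2) [simp del]

text \<open>By \<open>msum (Suc n) * mseq n = 1\<close> the reciprocals of the moments are their own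
  partial sums; \<open>lam 0 = 0\<close> matches the empty sum.\<close>

lemma lam_eq_msum: "lam n = msum n"
proof (cases n)
  case (Suc j)
  then show ?thesis
    using msum_Suc_mult_mseq[of j] mseq_pos[of j] by (simp add: lam_def field_simps)
qed (simp add: lam_def)

lemma inverse_lam_Suc: "1 / lam (Suc n) = mseq n"
  by (simp add: lam_def)

text \<open>This is \<open>psi (lam (Suc n)) = lam n\<close>: the sequence climbs from 0 along the
  positive branch.\<close>

lemma lam_Suc: "lam (Suc n) = lam n + 1 / lam (Suc n)"
  using lam_eq_msum[of n] lam_eq_msum[of "Suc n"] inverse_lam_Suc[of n] msum_Suc[of n] by simp

lemma lam_Suc_pos: "lam (Suc n) > 0"
  by (simp add: lam_eq_msum msum_Suc_pos)

text \<open>In the square of \<open>lam (Suc n) - 1 / lam (Suc n)\<close> the cross term is the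
  constant -2, so the squares grow by almost 2 per step.\<close>

lemma lam_Suc_square: "(lam (Suc n))\<^sup>2 = (lam n)\<^sup>2 + 2 - (1 / lam (Suc n))\<^sup>2"
proof -
  have "lam n = lam (Suc n) - 1 / lam (Suc n)" using lam_Suc[of n] by simp
  moreover have "lam (Suc n) * (1 / lam (Suc n)) = 1" using lam_Suc_pos[of n] by simp
  ultimately show ?thesis by (simp add: power2_diff del: times_divide_eq_right)
qed

lemma lam_Suc_ge_1: "lam (Suc n) \<ge> 1"
proof (induction n)
  case 0 then show ?case by (simp add: lam_def mseq_def)
next
  case (Suc n)
  have "1 / lam (Suc (Suc n)) > 0" using lam_Suc_pos[of "Suc n"] by simp
  then show ?case using lam_Suc[of "Suc n"] Suc by linarith
qed

section \<open>Growth of \<open>lam\<close>\<close>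

lemma harm_div_tendsto: "(\<lambda>n. (harm n :: real) / real n) \<longlonglongrightarrow> 0"
proof -
  have "(\<lambda>n. harm n - ln (real n) :: real) \<longlonglongrightarrow> euler_mascheroni"
    by (rule euler_mascheroni_LIMSEQ)
  then have "(\<lambda>n. (harm n - ln (real n)) / real n) \<longlonglongrightarrow> 0"
    by (rule real_tendsto_divide_at_top) (rule filterlim_real_sequentially)
  moreover have "(\<lambda>n. ln (real n) / real n) \<longlonglongrightarrow> 0"
    by (rule lim_ln_over_n)
  ultimately have "(\<lambda>n. (harm n - ln (real n)) / real n + ln (real n) / real n) \<longlonglongrightarrow> 0 + 0"
    by (rule tendsto_add)
  then show ?thesis by (simp add: diff_divide_distrib)
qed

text \<open>A bootstrap: the increments of the squares are at least 1, so the square of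
  \<open>lam n\<close> is at least \<open>n\<close>. Fed back into the exact increment, this leaves
  a deficit from \<open>2 * n\<close> of at most \<open>harm n\<close>, which is o(n).\<close>

lemma lam_square_tendsto: "(\<lambda>n. (lam n)\<^sup>2 / (2 * real n)) \<longlonglongrightarrow> 1"
proof (rule tendsto_sandwich)
  have step: "(lam (Suc n))\<^sup>2 - (lam n)\<^sup>2 \<ge> 1" for n
  proof -
    have "(1 / lam (Suc n))\<^sup>2 \<le> 1"
      using lam_Suc_ge_1[of n] by (intro power_le_one) auto
    then show ?thesis using lam_Suc_square[of n] by linarith
  qed
  have lower: "(lam n)\<^sup>2 \<ge> real n" for n
  proof (induction n)
    case (Suc n) then show ?case using step[of n] by simp
  qed simp
  have upper: "(lam n)\<^sup>2 \<le> 2 * real n" for n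
  proof (induction n)
    case 0 then show ?case by (simp add: lam_def)
  next
    case (Suc n)
    have "(lam (Suc n))\<^sup>2 \<le> (lam n)\<^sup>2 + 2" unfolding lam_Suc_square by simp
    then show ?case using Suc by simp
  qed
  have harm: "(lam n)\<^sup>2 \<ge> 2 * real n - harm n" for n
  proof (induction n)
    case (Suc n)
    have "(1 / lam (Suc n))\<^sup>2 \<le> inverse (real (Suc n))"
      using le_imp_inverse_le[OF lower[of "Suc n"]]
      by (simp add: power_divide inverse_eq_divide del: of_nat_Suc)
    then show ?case using Suc lam_Suc_square[of n] by (simp add: harm_Suc)
  qed (simp add: harm_def)
  show "eventually (\<lambda>n. (2 * real n - harm n) / (2 * real n) \<le> (lam n)\<^sup>2 / (2 * real n)) sequentially"
    using harm by (intro always_eventually allI divide_right_mono) auto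
  show "eventually (\<lambda>n. (lam n)\<^sup>2 / (2 * real n) \<le> 1) sequentially"
  proof (intro always_eventually allI)
    show "(lam n)\<^sup>2 / (2 * real n) \<le> 1" for n using upper[of n] by (cases "n = 0") (auto simp: divide_le_eq_1)
  qed
  have "(\<lambda>n. (harm n :: real) / real n) \<longlonglongrightarrow> 0"
    by (rule harm_div_tendsto)
  then have "(\<lambda>n. 1 - harm n / real n / 2) \<longlonglongrightarrow> 1 - 0 / 2"
    by (intro tendsto_intros) auto
  moreover have "eventually (\<lambda>n. 1 - harm n / real n / 2 = (2 * real n - harm n) / (2 * real n)) sequentially"
    using eventually_gt_at_top[of 0] by eventually_elim (auto simp: field_simps)
  ultimately show "(\<lambda>n. (2 * real n - harm n) / (2 * real n)) \<longlonglongrightarrow> 1"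
    by (simp add: tendsto_cong)
qed simp

lemma sqrt_div_lam_tendsto: "(\<lambda>n. sqrt (2 * real n) / lam n) \<longlonglongrightarrow> 1"
proof -
  have "(\<lambda>n. inverse (sqrt ((lam n)\<^sup>2 / (2 * real n)))) \<longlonglongrightarrow> inverse (sqrt 1)"
    by (intro tendsto_intros lam_square_tendsto) auto
  moreover have "eventually (\<lambda>n. inverse (sqrt ((lam n)\<^sup>2 / (2 * real n))) = sqrt (2 * real n) / lam n) sequentially"
    using eventually_gt_at_top[of 0]
  proof eventually_elim
    case (elim n)
    then show ?case using lam_Suc_pos[of "n - 1"] by (simp add: real_sqrt_divide)
  qed
  ultimately show ?thesis by (simp add: tendsto_cong)
qed

text \<open>Bounded index shifts are harmless; the squeezes of slopes below produce such
  shifts.\<close>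

lemma sqrt_div_lam_shift_tendsto:
  "(\<lambda>n. sqrt (2 * real (n + d)) / lam (n + c)) \<longlonglongrightarrow> 1"
proof -
  have "(\<lambda>n. sqrt (real (n + d) / real (n + c))) \<longlonglongrightarrow> sqrt 1"
  proof (intro tendsto_intros)
    have "(\<lambda>n. 1 + (real d - real c) / real (n + c)) \<longlonglongrightarrow> 1 + 0"
      by (intro tendsto_intros LIMSEQ_ignore_initial_segment lim_const_over_n)
    moreover have "eventually (\<lambda>n. 1 + (real d - real c) / real (n + c) = real (n + d) / real (n + c)) sequentially"
      using eventually_gt_at_top[of 0] by eventually_elim (auto simp: field_simps)
    ultimately show "(\<lambda>n. real (n + d) / real (n + c)) \<longlonglongrightarrow> 1"
      by (simp add: tendsto_cong)
  qed
  from tendsto_mult[OF this LIMSEQ_ignore_initial_segment[OF sqrt_div_lam_tendsto, of c]]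
  have "(\<lambda>n. sqrt (real (n + d) / real (n + c)) * (sqrt (2 * real (n + c)) / lam (n + c))) \<longlonglongrightarrow> 1"
    by simp
  moreover have "eventually (\<lambda>n. sqrt (real (n + d) / real (n + c)) * (sqrt (2 * real (n + c)) / lam (n + c))
      = sqrt (2 * real (n + d)) / lam (n + c)) sequentially"
    using eventually_gt_at_top[of 0]
    by eventually_elim (auto simp: real_sqrt_divide real_sqrt_mult simp flip: distrib_left of_nat_add)
  ultimately show ?thesis by (rule Lim_transform_eventually)
qed

section \<open>Bounded holomorphic functions on the right half-plane\<close>

text \<open>The squared norms differ by 4 a Re z. Hence (z - a)/(z + a) maps the right half-plane
  into the unit disc.\<close>

lemma norm_diff_less_norm_add_iff:
  assumes "a > 0"
  shows "norm (z - of_real a) < norm (z + of_real a) \<longleftrightarrow> Re z > 0"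
proof -
  have "norm (z - of_real a) < norm (z + of_real a) \<longleftrightarrow>
        (norm (z - of_real a))\<^sup>2 < (norm (z + of_real a))\<^sup>2"
    unfolding not_le[symmetric] by simp
  also have "\<dots> \<longleftrightarrow> Re z * a > 0"
    unfolding cmod_power2 by (simp add: power2_eq_square algebra_simps)
  finally show ?thesis using assms by (simp add: zero_less_mult_iff)
qed

text \<open>Stated separately because analytic continuation, removable singularities and punctured
  neighbourhoods all ask for it.\<close>

lemma open_right_half_plane: "open {z. Re z > 0}"
  by (simp add: open_halfspace_Re_gt)

lemma half_plane_Schwarz:
  fixes g :: "complex \<Rightarrow> complex"
  assumes holo: "g holomorphic_on {z. Re z > 0}"
    and bound: "\<And>z. Re z > 0 \<Longrightarrow> norm (g z) \<le> C"
    and a: "a > 0" "g (of_real a) = 0"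
    and z: "Re z > 0"
  shows "norm (g z) \<le> C * norm ((z - of_real a) / (z + of_real a))"
proof -
  define w where "w = (z - of_real a) / (z + of_real a)"
  \<comment> \<open>The inverse of the map (z - a)/(z + a); it carries the unit disc to the
    half-plane and 0 to \<open>a\<close>, so the Schwarz lemma applies to \<open>g\<close> composed
    with it.\<close>
  define \<phi> where "\<phi> = (\<lambda>w. of_real a * (1 + w) / (1 - w) :: complex)"
  have za: "z + of_real a \<noteq> 0" using z a by (auto simp: complex_eq_iff)
  have w1: "norm w < 1"
    using norm_diff_less_norm_add_iff[of a z] a z za by (simp add: w_def norm_divide)
  have "1 - w = 2 * of_real a / (z + of_real a)" "1 + w = 2 * z / (z + of_real a)"
    using za by (auto simp: w_def field_simps)
  then have \<phi>w: "\<phi> w = z"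
    using za a by (simp add: \<phi>_def)
  have Re_\<phi>: "Re (\<phi> u) > 0" if "norm u < 1" for u
  proof -
    have u: "1 - u \<noteq> 0" using that by auto
    define v where "v = 2 * of_real a / (1 - u)"
    have "\<phi> u + of_real a = v" "\<phi> u - of_real a = u * v"
      using u by (auto simp: \<phi>_def v_def field_simps)
    moreover have "v \<noteq> 0" using u a by (auto simp: v_def)
    ultimately have "norm (\<phi> u - of_real a) < norm (\<phi> u + of_real a)"
      using that by (simp add: norm_mult)
    then show ?thesis using norm_diff_less_norm_add_iff a by blast
  qed
  \<comment> \<open>The Schwarz lemma wants values strictly inside the disc, hence the scaling by
    some \<open>B > C\<close>; afterwards \<open>B\<close> decreases to \<open>C\<close>.\<close>
  have "norm (g z) \<le> B * norm w" if B: "B > C" for B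
  proof -
    have "C \<ge> 0" using bound[OF z] norm_ge_zero order_trans by blast
    then have B0: "B > 0" using B by simp
    define f where "f = (\<lambda>u. g (\<phi> u) / of_real B)"
    have "norm (f w) \<le> norm w"
    proof (rule Schwarz_Lemma(1))
      have "\<phi> holomorphic_on ball 0 1"
        unfolding \<phi>_def by (intro holomorphic_intros) auto
      then have "g \<circ> \<phi> holomorphic_on ball 0 1"
        by (rule holomorphic_on_compose_gen[OF _ holo]) (auto intro: Re_\<phi>)
      then show "f holomorphic_on ball 0 1"
        unfolding f_def o_def using B0 by (intro holomorphic_intros) auto
      show "f 0 = 0" using a by (simp add: f_def \<phi>_def)
      show "norm (f u) < 1" if "norm u < 1" for u
        using bound[OF Re_\<phi>[OF that]] B B0 by (simp add: f_def norm_divide)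
    qed (rule w1)
    then show ?thesis using B0 by (simp add: f_def \<phi>w norm_divide field_simps)
  qed
  note * = this
  show ?thesis unfolding w_def[symmetric]
  proof (rule tendsto_lowerbound)
    show "((\<lambda>B. B * norm w) \<longlongrightarrow> C * norm w) (at_right C)"
      by (intro tendsto_intros)
    show "eventually (\<lambda>B. norm (g z) \<le> B * norm w) (at_right C)"
      using eventually_at_right_less by (rule eventually_mono) (rule *)
  qed simp
qed

text \<open>Dividing out a zero by its Blaschke factor keeps the same bound \<open>C\<close>: off
  \<open>a\<close> this is the Schwarz estimate, at \<open>a\<close> it follows by
  continuity.\<close>

lemma half_plane_Blaschke_factor:
  fixes g :: "complex \<Rightarrow> complex"
  assumes holo: "g holomorphic_on {z. Re z > 0}"
    and bound: "\<And>z. Re z > 0 \<Longrightarrow> norm (g z) \<le> C"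
    and a: "a > 0" "g (of_real a) = 0"
  obtains h where "h holomorphic_on {z. Re z > 0}"
    and "\<And>z. Re z > 0 \<Longrightarrow> norm (h z) \<le> C"
    and "\<And>z. Re z > 0 \<Longrightarrow> g z = (z - of_real a) / (z + of_real a) * h z"
proof -
  \<comment> \<open>The quotient with its removable singularity at \<open>a\<close> filled in by the
    derivative.\<close>
  define h0 where "h0 = (\<lambda>z. if z = of_real a then deriv g (of_real a) else g z / (z - of_real a))"
  define h where "h = (\<lambda>z. (z + of_real a) * h0 z)"
  have "h0 holomorphic_on {z. Re z > 0}"
    by (rule pole_theorem_open_0[OF holo open_right_half_plane]) (auto simp: h0_def a)
  then have holo_h: "h holomorphic_on {z. Re z > 0}"
    unfolding h_def by (intro holomorphic_intros)
  have nz: "z + of_real a \<noteq> 0" if "Re z > 0" for z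
    using that a by (auto simp: complex_eq_iff)
  have fac: "g z = (z - of_real a) / (z + of_real a) * h z" if "Re z > 0" for z
    using nz[OF that] a by (simp add: h_def h0_def)
  have le: "norm (h z) \<le> C" if "Re z > 0" "z \<noteq> of_real a" for z
  proof -
    define w where "w = (z - of_real a) / (z + of_real a)"
    have "norm w > 0" using nz that by (simp add: w_def)
    moreover have "norm w * norm (h z) \<le> C * norm w"
      using half_plane_Schwarz[OF holo bound a that(1)] fac[OF that(1)]
      unfolding w_def[symmetric] by (simp only: norm_mult)
    ultimately show ?thesis by simp
  qed
  have "norm (h (of_real a)) \<le> C"
  proof (rule Lim_norm_ubound)
    have "isCont h (of_real a)"
      using holo_h open_right_half_plane a(1)
      by (metis (no_types, lifting) Re_complex_of_real continuous_on_eq_continuous_at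
          holomorphic_on_imp_continuous_on mem_Collect_eq)
    then show "(h \<longlongrightarrow> h (of_real a)) (at (of_real a))" by (simp add: isCont_def)
    show "eventually (\<lambda>z. norm (h z) \<le> C) (at (of_real a))"
      using eventually_at_in_open[OF open_right_half_plane, of "of_real a"] a(1)
      by (auto elim!: eventually_mono intro: le)
  qed simp
  with le have "norm (h z) \<le> C" if "Re z > 0" for z using that by (cases "z = of_real a") auto
  with holo_h fac show ?thesis using that by blast
qed

text \<open>Each factor has modulus (n - x)/(n + x) \<le> 1 - x/n \<le> exp(-x/n), and the exponents
  add up to a harmonic number.\<close>

lemma prod_Blaschke_le_exp_harm:
  assumes "0 < x" "x < 1"
  shows "norm (\<Prod>n=1..N. (of_real x - of_nat n) / (of_real x + of_nat n) :: complex) \<le> exp (- x * harm N)"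
proof (induction N)
  case (Suc N)
  define n where "n = real (Suc N)"
  have n: "n \<ge> 1" by (simp add: n_def)
  have "(of_real x - of_nat (Suc N)) / (of_real x + of_nat (Suc N)) = complex_of_real ((x - n) / (x + n))"
    by (simp add: n_def)
  then have "norm ((of_real x - of_nat (Suc N)) / (of_real x + of_nat (Suc N)) :: complex) = \<bar>(x - n) / (x + n)\<bar>"
    by (simp only: norm_of_real)
  also have "\<dots> = (n - x) / (n + x)"
    using assms n by (simp add: abs_divide)
  also have "\<dots> \<le> 1 - x / n"
    using assms n by (simp add: field_simps)
  also have "\<dots> \<le> exp (- (x / n))"
    using exp_ge_add_one_self[of "- (x / n)"] by simp
  finally have "norm ((of_real x - of_nat (Suc N)) / (of_real x + of_nat (Suc N)) :: complex) \<le> exp (- (x / n))" .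
  from mult_mono[OF Suc this] 
  have "norm (\<Prod>n=1..Suc N. (of_real x - of_nat n) / (of_real x + of_nat n) :: complex)
      \<le> exp (- x * harm N) * exp (- (x / n))"
    by (simp add: norm_mult del: of_nat_Suc times_divide_eq_right)
  also have "\<dots> = exp (- x * harm (Suc N))"
    by (simp add: harm_Suc n_def divide_inverse algebra_simps flip: exp_add)
  finally show ?case .
qed (simp add: harm_def)

text \<open>The nodes \<open>1, 2, 3, \<dots>\<close> violate the Blaschke condition.\<close>

lemma bounded_holomorphic_eq_0_at_nat_imp_0:
  fixes g :: "complex \<Rightarrow> complex"
  assumes holo: "g holomorphic_on {z. Re z > 0}"
    and bound: "\<And>z. Re z > 0 \<Longrightarrow> norm (g z) \<le> C"
    and zero: "\<And>n. n \<ge> 1 \<Longrightarrow> g (of_nat n) = 0"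
    and z: "Re z > 0"
  shows "g z = 0"
proof -
  \<comment> \<open>The first \<open>N\<close> zeros are divided out one by one, and the bound
    \<open>C\<close> on the cofactor does not deteriorate.\<close>
  have factor: "\<exists>h. h holomorphic_on {z. Re z > 0} \<and> (\<forall>z. Re z > 0 \<longrightarrow> norm (h z) \<le> C) \<and>
      (\<forall>z. Re z > 0 \<longrightarrow> g z = (\<Prod>n=1..N. (z - of_nat n) / (z + of_nat n)) * h z)" for N
  proof (induction N)
    case 0
    then show ?case using holo bound by (intro exI[of _ g]) auto
  next
    case (Suc N)
    then obtain h where h: "h holomorphic_on {z. Re z > 0}" "\<And>z. Re z > 0 \<Longrightarrow> norm (h z) \<le> C"
      "\<And>z. Re z > 0 \<Longrightarrow> g z = (\<Prod>n=1..N. (z - of_nat n) / (z + of_nat n)) * h z"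
      by blast
    \<comment> \<open>The factors already split off do not vanish at N + 1, so the zero of
      \<open>g\<close> there is a zero of the cofactor.\<close>
    have "(\<Prod>n=1..N. (of_nat (Suc N) - of_nat n) / (of_nat (Suc N) + of_nat n)) \<noteq> (0::complex)"
    proof -
      have "of_nat (Suc N) - of_nat n \<noteq> (0::complex)" "of_nat (Suc N) + of_nat n \<noteq> (0::complex)" if "n \<in> {1..N}" for n
        using that by (simp_all flip: of_nat_add of_nat_Suc del: of_nat_Suc)
      then show ?thesis by (simp del: of_nat_Suc)
    qed
    then have "h (of_real (real (Suc N))) = 0"
      using h(3)[of "of_nat (Suc N)"] zero[of "Suc N"] by (simp del: of_nat_Suc)
    from half_plane_Blaschke_factor[OF h(1,2) _ this]
    obtain k where k: "k holomorphic_on {z. Re z > 0}" "\<And>z. Re z > 0 \<Longrightarrow> norm (k z) \<le> C"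
      "\<And>z. Re z > 0 \<Longrightarrow> h z = (z - of_nat (Suc N)) / (z + of_nat (Suc N)) * k z"
      by (auto simp del: of_nat_Suc)
    then show ?case using h(3) by (intro exI[of _ k]) (simp del: of_nat_Suc)
  qed
  \<comment> \<open>On ]0, 1[ the Blaschke products tend to 0 because the harmonic series
    diverges.\<close>
  have real_zero: "g (of_real x) = 0" if x: "0 < x" "x < 1" for x
  proof -
    have le: "norm (g (of_real x)) \<le> exp (- x * harm N) * C" for N
    proof -
      let ?P = "\<Prod>n=1..N. (of_real x - of_nat n) / (of_real x + of_nat n) :: complex"
      from factor[of N] obtain h where h: "\<forall>z. Re z > 0 \<longrightarrow> norm (h z) \<le> C"
        "\<forall>z. Re z > 0 \<longrightarrow> g z = (\<Prod>n=1..N. (z - of_nat n) / (z + of_nat n)) * h z"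
        by blast
      have "Re (of_real x) > 0" using x by simp
      with h have "norm (h (of_real x)) \<le> C" "g (of_real x) = ?P * h (of_real x)"
        by blast+
      moreover have "norm ?P * norm (h (of_real x)) \<le> exp (- x * harm N) * C"
        by (rule mult_mono[OF prod_Blaschke_le_exp_harm[OF x] calculation(1)]) simp_all
      ultimately show ?thesis by (simp only: norm_mult)
    qed
    have "filterlim (\<lambda>N. - x * harm N) at_bot sequentially"
      using x harm_at_top by (intro filterlim_tendsto_neg_mult_at_bot[OF tendsto_const]) auto
    then have "(\<lambda>N. exp (- x * harm N) * C) \<longlonglongrightarrow> 0 * C"
      by (intro tendsto_intros filterlim_compose[OF exp_at_bot])
    then have "norm (g (of_real x)) \<le> 0"
      using le by (intro tendsto_lowerbound[where F = sequentially]) auto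
    then show ?thesis by simp
  qed
  show ?thesis
  proof (rule analytic_continuation[OF holo open_right_half_plane])
    show "connected {z. Re z > 0}"
      by (intro convex_connected convex_halfspace_Re_gt)
    show "of_real ` {0<..<1} \<subseteq> {z. Re z > 0}" by auto
    show "1/2 islimpt (of_real ` {0<..<1} :: complex set)"
      unfolding islimpt_approachable
    proof (intro allI impI)
      fix e :: real assume e: "e > 0"
      define d where "d = min (e/2) (1/4)"
      have d: "d > 0" "d < e" "d \<le> 1/4" using e by (auto simp: d_def)
      have "complex_of_real (1/2 + d) \<in> of_real ` {0<..<1}" using d by (intro imageI) auto
      moreover have "complex_of_real (1/2 + d) \<noteq> 1/2" using d by (simp add: complex_eq_iff)
      moreover have "dist (complex_of_real (1/2 + d)) (1/2) = d"
        using d by (simp add: dist_norm)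
      ultimately show "\<exists>x'\<in>complex_of_real ` {0<..<1}. x' \<noteq> 1/2 \<and> dist x' (1/2) < e"
        using d by metis
    qed
  qed (use z real_zero in auto)
qed

section \<open>The integral on the right half-plane\<close>

lemma norm_one_minus_exp_le:
  assumes "Re w \<le> 0"
  shows "norm (1 - exp w) \<le> norm w"
proof -
  \<comment> \<open>Mean value bound on the convex left half-plane, where |exp| is at most
    1.\<close>
  have "norm (exp 0 - exp w) \<le> 1 * norm (0 - w)"
  proof (rule field_differentiable_bound[where S = "{w. Re w \<le> 0}" and f' = exp])
    show "convex {w. Re w \<le> 0}" by (rule convex_halfspace_Re_le)
    show "(exp has_field_derivative exp z) (at z within {w. Re w \<le> 0})" for z :: complex
      by (auto intro!: derivative_eq_intros)
  qed (use assms in auto)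
  then show ?thesis by simp
qed

lemma norm_of_real_powr: "t \<ge> 0 \<Longrightarrow> norm (complex_of_real t powr z) = t powr Re z"
  by (simp add: norm_powr_real_powr)

lemma norm_of_real_powr_le_1:
  assumes "t \<in> {0..1}" "Re z > 0"
  shows "norm (complex_of_real t powr z) \<le> 1"
  using assms powr_mono2[of "Re z" t 1] by (simp add: norm_of_real_powr)

text \<open>For t < 1/2 the numerator is at most 2 and the denominator above 1/2. For larger t < 1
  the numerator is at most |z| |ln t| \<le> 2 |z| (1 - t), which cancels the denominator.\<close>

lemma norm_kern_le:
  assumes t: "t \<in> {0..1}" and z: "Re z > 0"
  shows "norm (kern z t) \<le> 2 * norm z + 4"
proof (cases "t < 1/2")
  case True
  have "norm (1 - complex_of_real t powr z) \<le> 1 + 1"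
    using norm_triangle_ineq4[of 1 "complex_of_real t powr z"] norm_of_real_powr_le_1[OF t z] by simp
  moreover have "norm (1 - complex_of_real t) = 1 - t"
    using t by (metis abs_of_nonneg atLeastAtMost_iff diff_ge_0_iff_ge norm_of_real of_real_1 of_real_diff)
  ultimately have "norm (kern z t) \<le> 2 / (1 - t)"
    using True by (simp add: kern_def norm_divide divide_right_mono)
  also have "\<dots> \<le> 2 / (1 / 2)" using True by (intro divide_left_mono) auto
  also have "\<dots> \<le> 2 * norm z + 4" by simp
  finally show ?thesis .
next
  case False
  show ?thesis
  proof (cases "t = 1")
    case True
    then show ?thesis using norm_ge_zero[of z] by (simp add: kern_def del: norm_ge_zero)
  next
    case t1: False
    define w where "w = z * of_real (ln t)"
    have ln: "ln t < 0" using t t1 False by simp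
    have "complex_of_real t powr z = exp w"
      using False by (simp add: powr_def w_def Ln_of_real)
    moreover have "Re w \<le> 0" using ln z by (simp add: w_def mult_nonneg_nonpos)
    ultimately have "norm (1 - complex_of_real t powr z) \<le> norm z * (- ln t)"
      using norm_one_minus_exp_le[of w] ln by (simp add: w_def norm_mult)
    also have "\<dots> \<le> norm z * (2 * (1 - t))"
    proof (intro mult_left_mono)
      have "- ln t = ln (1 / t)" using False by (simp add: ln_div)
      also have "\<dots> \<le> 1 / t - 1" using False by (intro ln_le_minus_one) auto
      also have "\<dots> = (1 - t) / t" using False by (simp add: field_simps)
      also have "\<dots> \<le> (1 - t) / (1 / 2)" using False t by (intro divide_left_mono) auto
      finally show "- ln t \<le> 2 * (1 - t)" by simp
    qed simp
    finally have *: "norm (1 - complex_of_real t powr z) \<le> norm z * (2 * (1 - t))" .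
    have "norm (1 - complex_of_real t) = 1 - t"
      using t by (metis abs_of_nonneg atLeastAtMost_iff diff_ge_0_iff_ge norm_of_real of_real_1 of_real_diff)
    then have "norm (kern z t) = norm (1 - complex_of_real t powr z) / (1 - t)"
      using t1 by (simp add: kern_def norm_divide)
    also have "\<dots> \<le> norm z * (2 * (1 - t)) / (1 - t)"
      using * t by (intro divide_right_mono) auto
    also have "\<dots> = 2 * norm z" using t1 by (simp add: field_simps)
    finally show ?thesis by simp
  qed
qed

text \<open>Here |t^z| \<le> t, so the numerator has real part at least 1 - t. Integrated, this
  keeps \<open>F (z + 1)\<close> away from 0.\<close>

lemma Re_kern_ge_1:
  assumes t: "t \<in> {0..1}" and z: "Re z \<ge> 1"
  shows "Re (kern z t) \<ge> 1"
proof (cases "t = 1")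
  case True
  then show ?thesis using z by (simp add: kern_def)
next
  case False
  have "Re (complex_of_real t powr z) \<le> t powr Re z"
    using complex_Re_le_cmod[of "complex_of_real t powr z"] t by (simp add: norm_of_real_powr)
  also have "\<dots> \<le> t powr 1"
    using t z by (intro powr_mono') auto
  also have "\<dots> = t" using t by simp
  finally have "1 - t \<le> Re (1 - complex_of_real t powr z)" by simp
  moreover have "kern z t = (1 - complex_of_real t powr z) / of_real (1 - t)"
    using False by (simp add: kern_def)
  ultimately show ?thesis using False t by (simp add: Re_divide_of_real le_divide_eq del: of_real_diff)
qed

text \<open>The numerators differ by t^z (1 - t). The resulting bounded increment makes the
  functional equation accessible to a bounded uniqueness theorem.\<close>

lemma kern_add_1:
  assumes "t \<in> {0..1}"
  shows "kern (z + 1) t - kern z t = complex_of_real t powr z"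
proof (cases "t = 1")
  case False
  have "complex_of_real t powr (z + 1) = complex_of_real t powr z * complex_of_real t"
    by (cases "t = 0") (auto simp: powr_add)
  then have "kern (z + 1) t - kern z t =
      (1 - complex_of_real t) * complex_of_real t powr z / (1 - complex_of_real t)"
    using False by (simp add: kern_def algebra_simps flip: diff_divide_distrib)
  moreover have "1 - complex_of_real t \<noteq> 0" using False by (simp add: complex_eq_iff)
  ultimately show ?thesis by simp
qed (simp add: kern_def)

text \<open>A finite geometric sum. For \<open>n = 0\<close> it would fail at \<open>t = 0\<close>,
  where \<open>0 powr 0 = 0\<close>.\<close>

lemma kern_of_nat:
  assumes "n \<ge> 1"
  shows "kern (of_nat n) t = of_real (\<Sum>j<n. t ^ j)"
proof (cases "t = 1")
  case False
  then have "1 - complex_of_real t \<noteq> 0" by (simp add: complex_eq_iff)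
  then show ?thesis
    using False assms
    by (simp add: kern_def powr_nat' sum_gp_strict flip: of_real_power)
qed (simp add: kern_def)

text \<open>Measurability is wanted on the whole line; for negative t the principal logarithm is ln
  |t| + i pi, which gives a measurable case formula.\<close>

lemma borel_measurable_of_real_powr [measurable]:
  "(\<lambda>t. complex_of_real t powr z) \<in> borel_measurable borel"
proof -
  have neg: "Ln (complex_of_real t) = of_real (ln \<bar>t\<bar>) + \<i> * of_real pi" if "t < 0" for t
  proof (rule Ln_unique)
    show "exp (of_real (ln \<bar>t\<bar>) + \<i> * of_real pi) = complex_of_real t"
      using that by (simp add: exp_add exp_of_real)
  qed (use that in \<open>auto simp: pi_gt_zero\<close>)
  have "complex_of_real t powr z = (if t = 0 then 0 else
      exp (z * (of_real (ln \<bar>t\<bar>) + (if t < 0 then \<i> * of_real pi else 0))))" for t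
    by (auto simp: powr_def neg Ln_of_real)
  then show ?thesis by simp
qed

lemma borel_measurable_kern [measurable]: "kern z \<in> borel_measurable borel"
  unfolding kern_def[abs_def] by measurable

section \<open>The real kernel and its concavity in the exponent\<close>

definition rkern :: "real \<Rightarrow> real \<Rightarrow> real" where
  "rkern x t = (if t = 1 then x else (1 - t powr x) / (1 - t))"

lemma kern_of_real: "t \<ge> 0 \<Longrightarrow> kern (of_real x) t = of_real (rkern x t)"
  by (simp add: kern_def rkern_def powr_of_real)

lemma borel_measurable_rkern [measurable]: "rkern x \<in> borel_measurable borel"
  unfolding rkern_def[abs_def] by measurable

text \<open>For t > 0 this is exp of a linear function, for t = 0 the constant 0. The equivalence
  suits rewriting, as \<open>convex_on\<close> includes convexity of the domain.\<close>

lemma convex_on_powr_exponent: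
  fixes t :: real
  assumes "t \<ge> 0"
  shows "convex_on A (\<lambda>x. t powr x) \<longleftrightarrow> convex A"
proof
  assume A: "convex A"
  show "convex_on A (\<lambda>x. t powr x)"
  proof (rule convex_onI[OF _ A])
    fix u x y :: real assume u: "0 < u" "u < 1"
    show "t powr ((1 - u) *\<^sub>R x + u *\<^sub>R y) \<le> (1 - u) * t powr x + u * t powr y"
    proof (cases "t = 0")
      case False
      have "exp ((1 - u) *\<^sub>R (x * ln t) + u *\<^sub>R (y * ln t)) \<le> (1 - u) * exp (x * ln t) + u * exp (y * ln t)"
        using u by (intro convex_onD[OF exp_convex]) auto
      then show ?thesis using False by (simp add: powr_def algebra_simps)
    qed simp
  qed
qed (rule convex_on_imp_convex)

lemma concave_on_rkern:
  assumes t: "t \<in> {0..1}"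
  shows "concave_on {0<..} (\<lambda>x. rkern x t)"
proof (cases "t = 1")
  case False
  have "concave_on {0<..} (\<lambda>x. 1 - t powr x)"
    using t by (intro concave_on_diff) (auto simp: concave_on_const convex_on_powr_exponent)
  then have "concave_on {0<..} (\<lambda>x. (1 - t powr x) / (1 - t))"
    using t by (intro concave_on_cdiv) auto
  then show ?thesis using False by (simp add: rkern_def)
qed (simp add: rkern_def concave_on_ident)

text \<open>The three-chord inequality settles \<open>b = c\<close>; otherwise two instances are
  chained through the chord over [b, c].\<close>

lemma concave_on_slope_mono:
  fixes f :: "real \<Rightarrow> real"
  assumes f: "concave_on I f" and "a \<in> I" "d \<in> I" "{a..d} \<subseteq> I" "a < b" "b \<le> c" "c < d"
  shows "(f d - f c) / (d - c) \<le> (f b - f a) / (b - a)"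
proof -
  let ?s = "\<lambda>x y. (f y - f x) / (y - x)"
  have *: "?s x z \<le> ?s x y \<and> ?s y z \<le> ?s x z" if "a \<le> x" "x < y" "y < z" "z \<le> d" for x y z
  proof -
    have xz: "x \<in> I" "z \<in> I" using that assms by auto
    have neg: "(- f p - - f q) / (p - q) = - ?s p q" for p q
      by (metis (no_types, opaque_lifting) minus_diff_eq minus_diff_minus minus_divide_divide minus_divide_left)
    show ?thesis
      using convex_on_slope_le[OF f[unfolded concave_on_def] xz that(2,3)] unfolding neg by simp
  qed
  show ?thesis
  proof (cases "b = c")
    case True then show ?thesis using *[of a b d] assms by auto
  next
    case False then show ?thesis using *[of a b c] *[of b c d] assms by auto
  qed
qed

section \<open>The integral transform of the measure\<close>

locale fixed_point_measure = prob_space M for M :: "real measure" +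
  assumes sets_M [measurable_cong]: "sets M = sets borel"
    and AE_01: "AE t in M. t \<in> {0..1}"
    and moments: "\<And>n. (\<integral>t. t ^ n \<partial>M) = mseq n"
begin

lemma integrable_kern:
  assumes "Re z > 0"
  shows "integrable M (kern z)"
proof (rule integrable_const_bound)
  show "AE t in M. norm (kern z t) \<le> 2 * norm z + 4"
    using AE_01 by eventually_elim (rule norm_kern_le[OF _ assms])
qed measurable

lemma integrable_power: "integrable M (\<lambda>t. t ^ n)"
proof (rule integrable_const_bound)
  show "AE t in M. norm (t ^ n) \<le> 1"
    using AE_01 by eventually_elim (simp add: power_le_one)
qed measurable

definition fpt :: "complex \<Rightarrow> complex" where "fpt z = (\<integral>t. kern z t \<partial>M)"

lemma norm_fpt_le:
  assumes "Re z > 0"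
  shows "norm (fpt z) \<le> 2 * norm z + 4"
proof -
  have "norm (fpt z) \<le> (\<integral>t. norm (kern z t) \<partial>M)"
    unfolding fpt_def by (rule integral_norm_bound)
  also have "\<dots> \<le> (\<integral>t. 2 * norm z + 4 \<partial>M)"
  proof (rule integral_mono_AE)
    show "AE t in M. norm (kern z t) \<le> 2 * norm z + 4"
      using AE_01 by eventually_elim (rule norm_kern_le[OF _ assms])
  qed (use integrable_kern[OF assms] in auto)
  also have "\<dots> = 2 * norm z + 4" by (simp add: prob_space)
  finally show ?thesis .
qed

lemma Re_fpt_ge_1:
  assumes "Re z \<ge> 1"
  shows "Re (fpt z) \<ge> 1"
proof -
  have int: "integrable M (kern z)" using assms by (intro integrable_kern) simp
  have "1 = (\<integral>t. (1::real) \<partial>M)" by (simp add: prob_space)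
  also have "\<dots> \<le> (\<integral>t. Re (kern z t) \<partial>M)"
  proof (rule integral_mono_AE)
    show "AE t in M. 1 \<le> Re (kern z t)"
      using AE_01 by eventually_elim (rule Re_kern_ge_1[OF _ assms])
  qed (use int in auto)
  also have "\<dots> = Re (fpt z)" unfolding fpt_def using int by (rule integral_Re)
  finally show ?thesis .
qed

lemma norm_fpt_add_1_diff_le:
  assumes "Re z > 0"
  shows "norm (fpt (z + 1) - fpt z) \<le> 1"
proof -
  have int: "integrable M (kern (z + 1))" "integrable M (kern z)"
    using assms by (auto intro: integrable_kern)
  have "fpt (z + 1) - fpt z = (\<integral>t. kern (z + 1) t - kern z t \<partial>M)"
    unfolding fpt_def using int by simp
  also have "norm \<dots> \<le> (\<integral>t. norm (kern (z + 1) t - kern z t) \<partial>M)"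
    by (rule integral_norm_bound)
  also have "\<dots> \<le> (\<integral>t. 1 \<partial>M)"
  proof (rule integral_mono_AE)
    show "AE t in M. norm (kern (z + 1) t - kern z t) \<le> 1"
      using AE_01 by eventually_elim (simp add: kern_add_1 norm_of_real_powr_le_1[OF _ assms])
  qed (use int in auto)
  finally show ?thesis by (simp add: prob_space)
qed

text \<open>Integrating the geometric sum gives a partial sum of the moments, and these are the
  values of \<open>lam\<close>.\<close>

lemma fpt_of_nat:
  assumes "n \<ge> 1"
  shows "fpt (of_nat n) = of_real (lam n)"
proof -
  have "fpt (of_nat n) = of_real (\<integral>t. (\<Sum>j<n. t ^ j) \<partial>M)"
    unfolding fpt_def kern_of_nat[OF assms]
    by (rule integral_of_real) (intro Bochner_Integration.integrable_sum integrable_power)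
  also have "(\<integral>t. (\<Sum>j<n. t ^ j) \<partial>M) = (\<Sum>j<n. mseq j)"
    by (subst Bochner_Integration.integral_sum) (auto intro: integrable_power simp: moments)
  also have "(\<Sum>j<n. mseq j) = msum n"
    by (induction n) (simp_all add: msum_Suc del: msum.simps(2))
  finally show ?thesis by (simp add: lam_eq_msum)
qed

section \<open>The transform on the positive real axis\<close>

definition phi :: "real \<Rightarrow> real" where "phi x = (\<integral>t. rkern x t \<partial>M)"

lemma integrable_rkern:
  assumes "x > 0"
  shows "integrable M (rkern x)"
proof (rule integrable_const_bound)
  show "AE t in M. norm (rkern x t) \<le> 2 * x + 4"
    using AE_01
  proof eventually_elim
    case (elim t)
    then show ?case using norm_kern_le[of t "of_real x"] assms by (simp add: kern_of_real)
  qed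
qed measurable

lemma fpt_of_real:
  assumes "x > 0"
  shows "fpt (of_real x) = of_real (phi x)"
proof -
  have "fpt (of_real x) = (\<integral>t. of_real (rkern x t) \<partial>M)"
    unfolding fpt_def
  proof (rule integral_cong_AE)
    show "AE t in M. kern (of_real x) t = of_real (rkern x t)"
      using AE_01 by eventually_elim (simp add: kern_of_real)
  qed measurable
  also have "\<dots> = of_real (phi x)"
    unfolding phi_def by (rule integral_of_real[OF integrable_rkern[OF assms]])
  finally show ?thesis .
qed

lemma phi_of_nat: "n \<ge> 1 \<Longrightarrow> phi (real n) = lam n"
  using fpt_of_nat[of n] fpt_of_real[of "real n"] by simp

lemma concave_on_phi: "concave_on {0<..} phi"
  unfolding concave_on_iff
proof (intro conjI ballI allI impI)
  fix x y u v :: real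
  assume *: "x \<in> {0<..}" "y \<in> {0<..}" "0 \<le> u" "0 \<le> v" "u + v = 1"
  then have pos: "u *\<^sub>R x + v *\<^sub>R y > 0"
    using convexD[of "{0<..}" x y u v] by (simp add: convex_real_interval)
  have "u * phi x + v * phi y = (\<integral>t. u * rkern x t + v * rkern y t \<partial>M)"
    unfolding phi_def using * by (simp add: integrable_rkern)
  also have "\<dots> \<le> phi (u *\<^sub>R x + v *\<^sub>R y)"
    unfolding phi_def
  proof (rule integral_mono_AE)
    show "AE t in M. u * rkern x t + v * rkern y t \<le> rkern (u *\<^sub>R x + v *\<^sub>R y) t"
      using AE_01
    proof eventually_elim
      case (elim t)
      then show ?case using concave_on_rkern[OF elim] * unfolding concave_on_iff by blast
    qed
  qed (use * pos in \<open>auto simp: integrable_rkern\<close>)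
  finally show "u * phi x + v * phi y \<le> phi (u *\<^sub>R x + v *\<^sub>R y)" .
qed (simp add: convex_real_interval)

text \<open>Concavity, compared with the chord over [n, n + 1] to the right, whose slope is
  \<open>lam (Suc n) - lam n = 1 / lam (Suc n)\<close>.\<close>

lemma phi_slope_ge:
  assumes "0 < x" "x < y" "y \<le> real n"
  shows "1 / lam (Suc n) \<le> (phi y - phi x) / (y - x)"
proof -
  have n: "n \<ge> 1" using assms by (cases n) auto
  have "(phi (real (Suc n)) - phi (real n)) / (real (Suc n) - real n) \<le> (phi y - phi x) / (y - x)"
    using assms by (intro concave_on_slope_mono[OF concave_on_phi]) auto
  moreover have "phi (real (Suc n)) - phi (real n) = 1 / lam (Suc n)" "real (Suc n) - real n = 1"
    using n phi_of_nat[of n] phi_of_nat[of "Suc n"] lam_Suc[of n] by auto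
  ultimately show ?thesis by simp
qed

text \<open>The same reference chord, now to the left; \<open>n \<ge> 1\<close> keeps it in the
  domain of concavity.\<close>

lemma phi_slope_le:
  assumes "n \<ge> 1" "real (Suc n) \<le> x" "x < y"
  shows "(phi y - phi x) / (y - x) \<le> 1 / lam (Suc n)"
proof -
  have "(phi y - phi x) / (y - x) \<le> (phi (real (Suc n)) - phi (real n)) / (real (Suc n) - real n)"
    using assms by (intro concave_on_slope_mono[OF concave_on_phi]) auto
  moreover have "phi (real (Suc n)) - phi (real n) = 1 / lam (Suc n)" "real (Suc n) - real n = 1"
    using assms phi_of_nat[of n] phi_of_nat[of "Suc n"] lam_Suc[of n] by auto
  ultimately show ?thesis by simp
qed

text \<open>Concavity alone would not give this; positive reference slopes arbitrarily far to the
  right do.\<close>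

lemma phi_strict_mono:
  assumes "0 < x" "x < y"
  shows "phi x < phi y"
proof -
  obtain n where "y \<le> real n" using real_arch_simple by blast
  then have "0 < (phi y - phi x) / (y - x)"
    using phi_slope_ge[OF assms] lam_Suc_pos[of n] by (metis divide_pos_pos less_le_trans zero_less_one)
  then show ?thesis using assms by (simp add: zero_less_divide_iff)
qed

end

section \<open>The functional equation\<close>

locale fixed_point_extension = fixed_point_measure +
  fixes F :: "complex \<Rightarrow> complex"
  assumes nicely_meromorphic_F: "F nicely_meromorphic_on UNIV"
    and F_eq_integral: "\<And>z. Re z > 0 \<Longrightarrow> F z = (\<integral>t. kern z t \<partial>M)"
begin

lemma F_eq_fpt: "Re z > 0 \<Longrightarrow> F z = fpt z"
  by (simp add: F_eq_integral fpt_def)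

lemma not_pole_imp_analytic: "\<not> is_pole F z \<Longrightarrow> F analytic_on {z}"
  using nicely_meromorphic_on_imp_analytic_at[OF nicely_meromorphic_F] by blast

text \<open>The integral grows at most linearly, so \<open>F\<close> has no pole here, and a nicely
  meromorphic function is analytic off its poles. No differentiation under the integral is
  involved.\<close>

lemma F_analytic_right:
  assumes z: "Re z > 0"
  shows "F analytic_on {z}"
proof (rule not_pole_imp_analytic, rule notI)
  assume "is_pole F z"
  \<comment> \<open>This constant exceeds the bound 2 |w| + 4 on the unit ball around
    \<open>z\<close>.\<close>
  moreover have "2 * (norm z + 1) + 5 > 0" by (intro add_nonneg_pos) auto
  ultimately have "eventually (\<lambda>w. norm (F w) \<ge> 2 * (norm z + 1) + 5) (at z)"
    unfolding is_pole_def filterlim_at_infinity[of 0, simplified] by blast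
  moreover have "eventually (\<lambda>w. w \<in> ball z 1 \<inter> {z. Re z > 0}) (at z)"
    using z by (intro eventually_at_in_open') (auto intro: open_right_half_plane)
  ultimately have "eventually (\<lambda>w. False) (at z)"
  proof eventually_elim
    case (elim w)
    then have w: "Re w > 0" "norm (w - z) < 1" by (auto simp: dist_norm norm_minus_commute)
    then have "norm w \<le> norm z + 1" using norm_triangle_ineq2[of w z] by simp
    then show ?case using elim norm_fpt_le[OF w(1)] F_eq_fpt[OF w(1)] by simp
  qed
  then show False by simp
qed

lemma F_holomorphic_right: "F holomorphic_on {z. Re z > 0}"
  by (rule analytic_imp_holomorphic) (use F_analytic_right analytic_on_analytic_at in blast)

lemma F_1: "F 1 = 1"
  using fpt_of_nat[of 1] by (simp add: F_eq_fpt lam_def mseq_def)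

text \<open>The two sides agree at the positive integers by the fixed point equation for the moments, and
  their difference is bounded.\<close>

lemma functional_equation_right:
  assumes z: "Re z > 0"
  shows "F z = F (z + 1) - 1 / F (z + 1)"
proof -
  define g where "g = (\<lambda>z. F (z + 1) - F z - 1 / F (z + 1))"
  have Re_ge: "Re (F (z + 1)) \<ge> 1" if "Re z > 0" for z
    using Re_fpt_ge_1[of "z + 1"] that by (simp add: F_eq_fpt)
  have nz: "F (z + 1) \<noteq> 0" if "Re z > 0" for z
    using Re_ge[OF that] by auto
  have "g z = 0"
  proof (rule bounded_holomorphic_eq_0_at_nat_imp_0[OF _ _ _ z])
    have "(\<lambda>z. F (z + 1)) holomorphic_on {z. Re z > 0}"
      by (rule holomorphic_on_compose_gen[OF _ F_holomorphic_right, unfolded o_def])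
         (auto intro!: holomorphic_intros)
    then show "g holomorphic_on {z. Re z > 0}"
      unfolding g_def using nz by (auto intro!: holomorphic_intros F_holomorphic_right)
    \<comment> \<open>The increment contributes at most 1, and so does the reciprocal, as
      \<open>Re (F (z + 1)) \<ge> 1\<close>.\<close>
    show "norm (g z) \<le> 2" if "Re z > 0" for z
    proof -
      have "1 \<le> norm (F (z + 1))" using Re_ge[OF that] complex_Re_le_cmod order_trans by blast
      then have "norm (1 / F (z + 1)) \<le> 1" by (auto simp: norm_divide divide_le_eq_1)
      moreover have "norm (F (z + 1) - F z) \<le> 1"
        using norm_fpt_add_1_diff_le[OF that] that by (simp add: F_eq_fpt)
      ultimately show ?thesis
        unfolding g_def using norm_triangle_ineq4[of "F (z + 1) - F z" "1 / F (z + 1)"] by linarith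
    qed
    show "g (of_nat n) = 0" if n: "n \<ge> 1" for n
    proof -
      have "of_nat n + 1 = (of_nat (Suc n) :: complex)" by simp
      then have "F (of_nat n + 1) = of_real (lam (Suc n))" "F (of_nat n) = of_real (lam n)"
        using n fpt_of_nat[of n] fpt_of_nat[of "Suc n"]
        by (simp_all only: F_eq_fpt) (simp_all add: F_eq_fpt add_ac)
      then have "g (of_nat n) = of_real (lam (Suc n) - lam n - 1 / lam (Suc n))"
        by (simp add: g_def)
      moreover have "lam (Suc n) - lam n - 1 / lam (Suc n) = 0" using lam_Suc[of n] by simp
      ultimately show ?thesis by (simp only: of_real_0)
    qed
  qed
  then show ?thesis by (simp add: g_def algebra_simps)
qed

section \<open>Continuation of the functional equation to the plane\<close>

lemma functional_equation_eventually:
  "eventually (\<lambda>w. F w = F (w + 1) - 1 / F (w + 1)) (at z)"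
proof -
  define D where "D = (\<lambda>w. F w - (F (w + 1) - 1 / F (w + 1)))"
  have F: "F meromorphic_on UNIV"
    using nicely_meromorphic_F by (simp add: nicely_meromorphic_on_def)
  have "(\<lambda>w. F (w + 1)) meromorphic_on UNIV"
    by (rule meromorphic_on_compose[OF F]) (auto intro!: analytic_intros)
  then have "D meromorphic_on UNIV"
    unfolding D_def by (intro meromorphic_intros F)
  \<comment> \<open>On the connected plane \<open>D\<close> vanishes off a sparse set or only on
    one; the half-plane identity near 1 excludes the latter.\<close>
  then consider "\<forall>\<^sub>\<approx>w\<in>UNIV. D w = 0" | "\<forall>\<^sub>\<approx>w\<in>UNIV. D w \<noteq> 0"
    using meromorphic_imp_constant_or_avoid[of D UNIV 0] by auto
  then have "\<forall>\<^sub>\<approx>w\<in>UNIV. D w = 0"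
  proof cases
    case 2
    then have "eventually (\<lambda>w. D w \<noteq> 0) (at 1)" by (simp add: eventually_cosparse_open_eq)
    moreover have "eventually (\<lambda>w. w \<in> {z. Re z > 0}) (at (1::complex))"
      by (intro eventually_at_in_open' open_right_half_plane) auto
    ultimately have "eventually (\<lambda>w. False) (at (1::complex))"
    proof eventually_elim
      case (elim w)
      then have "F w = F (w + 1) - 1 / F (w + 1)" by (intro functional_equation_right) simp
      with elim show ?case unfolding D_def by simp
    qed
    then show ?thesis by simp
  qed
  then have "eventually (\<lambda>w. D w = 0) (at z)" by (simp add: eventually_cosparse_open_eq)
  then show ?thesis by (simp add: D_def)
qed

lemma analytic_shift:
  assumes "F analytic_on {z + 1}"
  shows "(\<lambda>w. F (w + 1)) analytic_on {z}"
  by (rule analytic_on_compose_gen[OF _ assms, unfolded o_def]) (auto intro!: analytic_intros)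

text \<open>The right-hand side is analytic at \<open>z\<close>, so \<open>F\<close> has a finite
  limit and no pole there, and niceness makes \<open>F z\<close> that limit. Equality then holds on
  a full neighbourhood and may be differentiated.\<close>

lemma
  assumes "F analytic_on {z + 1}" "F (z + 1) \<noteq> 0"
  shows functional_equation_analytic: "F analytic_on {z}"
    and functional_equation: "F z = F (z + 1) - 1 / F (z + 1)"
    and functional_equation_deriv: "deriv F z = deriv F (z + 1) * (1 + 1 / (F (z + 1))\<^sup>2)"
proof -
  define G where "G = (\<lambda>w. F (w + 1) - 1 / F (w + 1))"
  have "G analytic_on {z}"
    unfolding G_def using assms by (intro analytic_intros analytic_shift) auto
  then have "G \<midarrow>z\<rightarrow> G z"
    using analytic_at_imp_isCont isContD by blast
  then have lim: "F \<midarrow>z\<rightarrow> G z"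
    using functional_equation_eventually[of z] by (subst tendsto_cong[of F G]) (auto simp: G_def)
  then have np: "\<not> is_pole F z"
    unfolding is_pole_def using not_tendsto_and_filterlim_at_infinity[of "at z" F "G z"] by auto
  then show "F analytic_on {z}" by (rule not_pole_imp_analytic)
  have "F \<midarrow>z\<rightarrow> F z"
    using nicely_meromorphic_F np by (auto simp: nicely_meromorphic_on_def)
  then have Fz: "F z = G z" using lim LIM_unique by blast
  then show "F z = F (z + 1) - 1 / F (z + 1)" by (simp add: G_def)
  have "eventually (\<lambda>w. F w = G w) (nhds z)"
    using functional_equation_eventually[of z] Fz by (simp add: eventually_nhds_conv_at G_def)
  then have "deriv F z = deriv G z" by (intro deriv_cong_ev) auto
  also have "\<dots> = deriv F (z + 1) * (1 + 1 / (F (z + 1))\<^sup>2)"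
  proof (rule DERIV_imp_deriv)
    have "F field_differentiable (at (z + 1))"
      using assms(1) analytic_on_imp_differentiable_at by blast
    then have "(F has_field_derivative deriv F (z + 1)) (at (z + 1))"
      by (rule field_differentiable_derivI)
    then have "((\<lambda>w. F (w + 1)) has_field_derivative deriv F (z + 1)) (at z)"
      by (simp add: DERIV_shift)
    then show "(G has_field_derivative deriv F (z + 1) * (1 + 1 / (F (z + 1))\<^sup>2)) (at z)"
      unfolding G_def using assms(2)
      by (auto intro!: derivative_eq_intros simp: field_simps power2_eq_square)
  qed
  finally show "deriv F z = deriv F (z + 1) * (1 + 1 / (F (z + 1))\<^sup>2)" .
qed

text \<open>\<open>F 1 = 1\<close> excludes the constant 0. Isolated zeros are needed for 1/F to
  tend to infinity at a zero.\<close>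

lemma eventually_F_nonzero: "eventually (\<lambda>w. F w \<noteq> 0) (at z)"
proof -
  have "\<forall>\<^sub>\<approx>x\<in>UNIV. F x \<noteq> 0"
    using nicely_meromorphic_imp_constant_or_avoid[OF nicely_meromorphic_F open_UNIV connected_UNIV, of 0] F_1
    by auto
  then show ?thesis by (simp add: eventually_cosparse_open_eq)
qed

section \<open>Zeros and poles create poles one unit to the left\<close>

lemma filterlim_plus_1: "filterlim (\<lambda>w. w + 1) (at (z + 1)) (at (z :: complex))"
  by (auto simp: filterlim_at eventually_at_filter intro!: tendsto_eq_intros)

text \<open>In \<open>F (w + 1) - 1 / F (w + 1)\<close> the first term blows up while the second
  tends to 0.\<close>

lemma pole_propagates:
  assumes "is_pole F (z + 1)"
  shows "is_pole F z"
proof -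
  have inf: "filterlim (\<lambda>w. F (w + 1)) at_infinity (at z)"
    using assms unfolding is_pole_def by (rule filterlim_compose[OF _ filterlim_plus_1])
  then have "((\<lambda>w. inverse (F (w + 1))) \<longlongrightarrow> 0) (at z)"
    by (rule filterlim_compose[OF tendsto_inverse_0])
  then have "((\<lambda>w. - (1 / F (w + 1))) \<longlongrightarrow> - 0) (at z)"
    by (intro tendsto_minus) (simp add: inverse_eq_divide)
  then have "filterlim (\<lambda>w. - (1 / F (w + 1)) + F (w + 1)) at_infinity (at z)"
    using inf by (rule tendsto_add_filterlim_at_infinity)
  then have "is_pole (\<lambda>w. F (w + 1) - 1 / F (w + 1)) z" by (simp add: is_pole_def)
  then show ?thesis
    using is_pole_cong[OF functional_equation_eventually refl] by simp
qed

text \<open>As for poles, with the roles of the two terms exchanged.\<close>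

lemma zero_gives_pole:
  assumes ana: "F analytic_on {z + 1}" and zero: "F (z + 1) = 0"
  shows "is_pole F z"
proof -
  have "isCont F (z + 1)" using ana by (rule analytic_at_imp_isCont)
  then have "filterlim F (at 0) (at (z + 1))"
    using eventually_F_nonzero[of "z + 1"] zero by (simp add: filterlim_at isCont_def)
  then have lim: "filterlim (\<lambda>w. F (w + 1)) (at 0) (at z)"
    by (rule filterlim_compose[OF _ filterlim_plus_1])
  then have "filterlim (\<lambda>w. inverse (F (w + 1))) at_infinity (at z)"
    by (rule filterlim_compose[OF filterlim_inverse_at_infinity])
  then have "filterlim (\<lambda>w. - inverse (F (w + 1))) at_infinity (at z)"
    by (simp add: filterlim_at_infinity_conv_norm_at_top)
  moreover have "((\<lambda>w. F (w + 1)) \<longlongrightarrow> 0) (at z)"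
    using lim by (simp add: filterlim_at)
  ultimately have "filterlim (\<lambda>w. F (w + 1) + - inverse (F (w + 1))) at_infinity (at z)"
    by (intro tendsto_add_filterlim_at_infinity)
  then have "is_pole (\<lambda>w. F (w + 1) - 1 / F (w + 1)) z" by (simp add: is_pole_def inverse_eq_divide)
  then show ?thesis
    using is_pole_cong[OF functional_equation_eventually refl] by simp
qed

end

section \<open>Zeros and asymptotics\<close>

context fixed_point_extension
begin

section \<open>Real values of \<open>F\<close> to the right of -1\<close>

lemma F_of_real_pos: "x > 0 \<Longrightarrow> F (of_real x) = of_real (phi x)"
  by (simp add: F_eq_fpt fpt_of_real)

text \<open>The integrand yields only nonnegativity; strictness comes from comparison with
  \<open>x / 2\<close>.\<close>

lemma phi_pos:
  assumes "x > 0"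
  shows "phi x > 0"
proof -
  have "0 \<le> phi (x / 2)"
    unfolding phi_def
  proof (rule integral_nonneg_AE)
    show "AE t in M. 0 \<le> rkern (x / 2) t"
      using AE_01 by eventually_elim (use assms powr_le1[of "x / 2"] in \<open>auto simp: rkern_def\<close>)
  qed
  also have "\<dots> < phi x" using assms by (intro phi_strict_mono) auto
  finally show ?thesis .
qed

lemma phi_1: "phi 1 = 1"
  using phi_of_nat[of 1] by (simp add: lam_def mseq_def)

text \<open>The restriction of \<open>F\<close> to ]-1, \<infinity>[, reached by one step of the
  functional equation from the positive axis, where the integral is available.\<close>

definition Phi :: "real \<Rightarrow> real" where "Phi x = psi (phi (x + 1))"

lemma of_real_psi: "complex_of_real x - 1 / complex_of_real x = of_real (psi x)"
  by (simp add: psi_def)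

lemma
  assumes "x > -1"
  shows F_analytic_real: "F analytic_on {of_real x}"
    and F_of_real: "F (of_real x) = of_real (Phi x)"
    and deriv_F_step: "deriv F (of_real x) = deriv F (of_real x + 1) * of_real (1 + 1 / (phi (x + 1))\<^sup>2)"
proof -
  have x: "of_real x + 1 = complex_of_real (x + 1)" by simp
  have 1: "F analytic_on {of_real x + 1}" using assms by (intro F_analytic_right) simp
  have 2: "F (of_real x + 1) = of_real (phi (x + 1))"
    unfolding x using assms by (intro F_of_real_pos) simp
  have 3: "F (of_real x + 1) \<noteq> 0" using phi_pos[of "x + 1"] assms 2 by simp
  show "F analytic_on {of_real x}" by (rule functional_equation_analytic[OF 1 3])
  show "F (of_real x) = of_real (Phi x)"
    using functional_equation[OF 1 3] by (simp only: 2 of_real_psi Phi_def)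
  show "deriv F (of_real x) = deriv F (of_real x + 1) * of_real (1 + 1 / (phi (x + 1))\<^sup>2)"
    using functional_equation_deriv[OF 1 3] unfolding 2 by simp
qed

lemma Phi_eq_phi: "x > 0 \<Longrightarrow> Phi x = phi x"
  using F_of_real[of x] F_of_real_pos[of x] by simp

lemma Phi_strict_mono: "-1 < x \<Longrightarrow> x < y \<Longrightarrow> Phi x < Phi y"
  unfolding Phi_def by (intro psi_strict_mono_pos phi_pos phi_strict_mono) auto

lemma Phi_0: "Phi 0 = 0"
  by (simp add: Phi_def phi_1 psi_def)

lemma continuous_on_phi: "continuous_on {0<..} phi"
proof -
  have "continuous_on {0<..} (\<lambda>x. - phi x)"
    using concave_on_phi unfolding concave_on_def by (intro convex_on_continuous) auto
  then show ?thesis using continuous_on_minus by fastforce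
qed

lemma phi_small:
  assumes "r > 0"
  obtains x where "0 < x" "x < 1" "phi x < r"
proof -
  have "isCont F 0"
    using F_analytic_real[of 0] by (intro analytic_at_imp_isCont) simp
  moreover have "F 0 = 0" using F_of_real[of 0] Phi_0 by simp
  ultimately obtain d where d: "d > 0" "\<And>z. norm z < d \<Longrightarrow> norm (F z) < r"
    using assms unfolding continuous_at_eps_delta by (auto simp: dist_norm)
  define x where "x = min (d / 2) (1 / 2)"
  have x: "0 < x" "x < 1" "x < d" using d by (auto simp: x_def)
  then have "phi x < r" using d(2)[of "of_real x"] phi_pos[of x] by (simp add: F_of_real_pos)
  with x show ?thesis using that by blast
qed

text \<open>The positive preimage \<open>r\<close> of \<open>s\<close> lies in ]0, 1[. The
  intermediate value theorem, between a small value of \<open>phi\<close> and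
  \<open>phi 1 = 1\<close>, gives a point with value \<open>r\<close>; one unit to its left
  \<open>Phi\<close> equals \<open>s\<close>.\<close>

lemma Phi_surj:
  assumes s: "s < 0"
  obtains x where "-1 < x" "x < 0" "Phi x = s"
proof -
  define r where "r = psi_inv_pos s"
  have r0: "r > 0" by (simp add: r_def psi_inv_pos_pos)
  have "psi_inv_pos 0 = 1" by (simp add: psi_inv_pos_def)
  then have r1: "r < 1" using strict_mono_psi_inv_pos s by (metis r_def strict_monoD)
  obtain a where a: "0 < a" "a < 1" "phi a < r" using phi_small[OF r0] .
  have "continuous_on {a..1} phi"
    by (rule continuous_on_subset[OF continuous_on_phi]) (use a in auto)
  then obtain y where y: "a \<le> y" "y \<le> 1" "phi y = r"
    using IVT'[of phi a r 1] a r1 phi_1 by auto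
  then have "y \<noteq> 1" using r1 phi_1 by auto
  then show ?thesis
    using that[of "y - 1"] y a by (simp add: Phi_def r_def)
qed

lemma Phi_neg: "-1 < x \<Longrightarrow> x < 0 \<Longrightarrow> Phi x < 0"
  using Phi_strict_mono[of x 0] Phi_0 by simp

text \<open>\<open>phi\<close> is positive, so each unit step to the right selects the positive
  inverse branch.\<close>

lemma lams_Phi:
  assumes "x > -1"
  shows "lams (Phi x) n = Phi (x + real n)"
proof (induction n)
  case (Suc n)
  define w where "w = x + real n + 1"
  have w: "w > 0" using assms by (simp add: w_def)
  have "phi w = psi_inv_pos (psi (phi w))"
    using psi_eq_iff[of "phi w" "psi (phi w)"] phi_pos[OF w] psi_inv_neg_neg[of "psi (phi w)"] by auto
  then show ?case
    using Suc Phi_eq_phi[OF w] by (simp add: lams_Suc Phi_def w_def add_ac del: lams.simps)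
qed simp

section \<open>Orbits to the left and the location of the zeros\<close>

lemma is_pole_diff_nat: "is_pole F z \<Longrightarrow> is_pole F (z - of_nat k)"
proof (induction k)
  case (Suc k)
  then have "is_pole F (z - of_nat (Suc k) + 1)" by simp
  then show ?case by (rule pole_propagates)
qed simp

text \<open>The three claims go through one induction, since each step of the functional equation
  needs analyticity and a nonzero value at the point to its right.\<close>

lemma orbit:
  assumes "-1 < y" "\<And>i. i < j \<Longrightarrow> (psi ^^ i) (Phi y) \<noteq> 0"
  shows "F analytic_on {of_real (y - real j)} \<and> F (of_real (y - real j)) = of_real ((psi ^^ j) (Phi y)) \<and>
    deriv F (of_real (y - real j)) =
      deriv F (of_real y) * of_real (\<Prod>i<j. 1 + 1 / ((psi ^^ i) (Phi y))\<^sup>2)"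
  using assms(2)
proof (induction j)
  case 0
  then show ?case using assms(1) by (simp add: F_analytic_real F_of_real)
next
  case (Suc j)
  define z where "z = complex_of_real (y - real (Suc j))"
  define v where "v = (psi ^^ j) (Phi y)"
  have z: "z + 1 = complex_of_real (y - real j)" by (simp add: z_def)
  have IH: "F analytic_on {z + 1}" "F (z + 1) = of_real v"
    "deriv F (z + 1) = deriv F (of_real y) * of_real (\<Prod>i<j. 1 + 1 / ((psi ^^ i) (Phi y))\<^sup>2)"
    unfolding z v_def using Suc by auto
  have v: "v \<noteq> 0" using Suc.prems by (simp add: v_def)
  then have nz: "F (z + 1) \<noteq> 0" using IH by simp
  show ?case
    unfolding z_def[symmetric]
    using functional_equation_analytic[OF IH(1) nz] functional_equation[OF IH(1) nz]
      functional_equation_deriv[OF IH(1) nz]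
    unfolding IH(2,3) of_real_psi by (simp add: v_def[symmetric] mult.assoc)
qed

text \<open>If an iterate vanished before step \<open>p\<close>, then \<open>F\<close> would have a
  zero on the way, hence a pole one unit further left and at every later point, including the
  supposed zero.\<close>

lemma is_zero_iff_Yset:
  assumes "-1 < y"
  shows "is_zero F (of_real (y - real p)) \<longleftrightarrow> Phi y \<in> Yset p"
proof
  assume "Phi y \<in> Yset p"
  then show "is_zero F (of_real (y - real p))"
    using orbit[OF assms, of p] by (auto simp: Yset_def is_zero_def analytic_at_imp_no_pole)
next
  assume zero: "is_zero F (of_real (y - real p))"
  have nz: "(psi ^^ i) (Phi y) \<noteq> 0" if "i < p" for i
    using that
  \<comment> \<open>Strong induction: \<open>orbit\<close> reaches index \<open>i\<close> only if
    all earlier iterates are nonzero.\<close>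
  proof (induction i rule: less_induct)
    case (less i)
    show ?case
    proof
      assume 0: "(psi ^^ i) (Phi y) = 0"
      define z where "z = complex_of_real (y - real (Suc i))"
      have z: "z + 1 = complex_of_real (y - real i)" by (simp add: z_def)
      have "F analytic_on {z + 1}" "F (z + 1) = 0"
        unfolding z using orbit[OF assms, of i] less 0 by auto
      then have "is_pole F z" by (rule zero_gives_pole)
      then have "is_pole F (z - of_nat (p - Suc i))" by (rule is_pole_diff_nat)
      moreover have "z - of_nat (p - Suc i) = complex_of_real (y - real p)"
        using less.prems by (simp add: z_def of_nat_diff)
      ultimately show False using zero by (simp add: is_zero_def)
    qed
  qed
  have "F (of_real (y - real p)) = of_real ((psi ^^ p) (Phi y))"
    using orbit[OF assms, of p] nz by blast
  with zero have "(psi ^^ p) (Phi y) = 0" by (simp add: is_zero_def)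
  with nz show "Phi y \<in> Yset p" by (simp add: Yset_def)
qed

text \<open>x \<mapsto> \<open>Phi (x + real p)\<close> is an increasing bijection from the zeros in
  the interval onto the negative elements of \<open>Yset p\<close>. These come first in the sorted
  list, so the rank \<open>k\<close> is unchanged.\<close>

lemma xi_characterization:
  assumes p: "p \<ge> 1" and k: "k \<in> {1..2 ^ (p - 1)}"
  shows "- real p - 1 < xi F p k" "xi F p k < - real p" "Phi (xi F p k + real p) = alpha p k"
proof -
  define Z where "Z = {x::real. - real p - 1 < x \<and> x < - real p \<and> is_zero F (complex_of_real x)}"
  define g where "g = (\<lambda>x. Phi (x + real p))"
  have mono: "strict_mono_on Z g"
    by (auto simp: strict_mono_on_def Z_def g_def intro!: Phi_strict_mono)
  have zero: "is_zero F (of_real x) \<longleftrightarrow> g x \<in> Yset p" if "x > - real p - 1" for x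
    using is_zero_iff_Yset[of "x + real p" p] that by (simp add: g_def)
  have img: "g ` Z = Yset p \<inter> {..<0}"
  proof (intro set_eqI iffI)
    fix s assume "s \<in> g ` Z"
    then show "s \<in> Yset p \<inter> {..<0}"
      using zero by (auto simp: Z_def) (auto simp: g_def intro!: Phi_neg)
  next
    fix s assume s: "s \<in> Yset p \<inter> {..<0}"
    then obtain y where y: "-1 < y" "y < 0" "Phi y = s" using Phi_surj[of s] by auto
    then have gs: "g (y - real p) = s" by (simp add: g_def)
    then have "y - real p \<in> Z"
      using y s zero[of "y - real p"] by (auto simp: Z_def)
    then show "s \<in> g ` Z" using gs by blast
  qed
  have fin: "finite Z"
    using finite_imageD[of g Z] img finite_Yset strict_mono_on_imp_inj_on[OF mono] by simp
  have eq: "map g (sorted_list_of_set Z) = take (2 ^ (p - 1)) (sorted_list_of_set (Yset p))"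
    using sorted_list_of_set_image_strict_mono[OF fin mono] sorted_list_of_Yset_neg[OF p]
    unfolding img by simp
  have "length (sorted_list_of_set Z) = 2 ^ (p - 1)"
    using arg_cong[OF eq, of length] by (simp add: finite_Yset card_Yset)
  then have len: "k - 1 < length (sorted_list_of_set Z)" using k by auto
  have xi: "xi F p k = sorted_list_of_set Z ! (k - 1)" by (simp add: xi_def Z_def)
  then have "xi F p k \<in> Z" using nth_mem[OF len] fin by simp
  then show "- real p - 1 < xi F p k" "xi F p k < - real p" by (auto simp: Z_def)
  have "g (xi F p k) = map g (sorted_list_of_set Z) ! (k - 1)"
    using len by (simp add: xi)
  also have "\<dots> = alpha p k"
    unfolding eq using k by (auto simp: alpha_def)
  finally show "Phi (xi F p k + real p) = alpha p k" by (simp add: g_def)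
qed

section \<open>Asymptotics of increments and derivatives\<close>

lemma deriv_F_of_real:
  assumes x: "x > 0"
  obtains d where "deriv F (of_real x) = of_real d" "(phi has_real_derivative d) (at x)"
proof -
  have "F field_differentiable (at (of_real x))"
    using F_analytic_real[of x] x by (intro analytic_on_imp_differentiable_at) auto
  then have "(F has_field_derivative deriv F (of_real x)) (at (of_real x))"
    by (rule field_differentiable_derivI)
  then have vec: "((\<lambda>u. F (of_real u)) has_vector_derivative deriv F (of_real x)) (at x)"
    by (rule has_vector_derivative_real_field)
  have ev: "eventually (\<lambda>u. u \<in> {0<..}) (nhds x)"
    using x by (intro eventually_nhds_in_open) auto
  have Re: "((\<lambda>u. Re (F (of_real u))) has_vector_derivative Re (deriv F (of_real x))) (at x)"
    and Im: "((\<lambda>u. Im (F (of_real u))) has_vector_derivative Im (deriv F (of_real x))) (at x)"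
    using bounded_linear.has_vector_derivative[OF bounded_linear_Re vec]
      bounded_linear.has_vector_derivative[OF bounded_linear_Im vec] by auto
  have "((\<lambda>u. Re (F (of_real u))) has_real_derivative Re (deriv F (of_real x))) (at x)"
    using Re by (simp add: has_real_derivative_iff_has_vector_derivative)
  then have Re': "(phi has_real_derivative Re (deriv F (of_real x))) (at x)"
    by (rule DERIV_cong_ev[THEN iffD1, OF refl _ refl, rotated])
       (use ev in eventually_elim, simp add: F_of_real_pos)
  \<comment> \<open>\<open>F\<close> is real on the positive axis, so its imaginary part is locally
    the constant 0.\<close>
  have "((\<lambda>u. Im (F (of_real u))) has_real_derivative Im (deriv F (of_real x))) (at x)"
    using Im by (simp add: has_real_derivative_iff_has_vector_derivative)
  then have "((\<lambda>u. 0) has_real_derivative Im (deriv F (of_real x))) (at x)"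
    by (rule DERIV_cong_ev[THEN iffD1, OF refl _ refl, rotated])
       (use ev in eventually_elim, simp add: F_of_real_pos)
  then have "Im (deriv F (of_real x)) = 0"
    using DERIV_unique DERIV_const by blast
  then show ?thesis using that[OF _ Re'] by (simp add: complex_eq_iff)
qed

text \<open>The slope bounds pass to the limit of right difference quotients;
  \<open>x < real n\<close> leaves room for x + h \<le> n.\<close>

lemma deriv_phi_bounds:
  assumes d: "(phi has_real_derivative d) (at x)" and x: "x > 0"
  shows "x < real n \<Longrightarrow> 1 / lam (Suc n) \<le> d"
    and "n \<ge> 1 \<Longrightarrow> real (Suc n) \<le> x \<Longrightarrow> d \<le> 1 / lam (Suc n)"
proof -
  have lim: "((\<lambda>h. (phi (x + h) - phi x) / h) \<longlongrightarrow> d) (at_right 0)"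
    using d unfolding DERIV_def by (rule filterlim_mono) (auto simp: at_le)
  show "1 / lam (Suc n) \<le> d" if n: "x < real n"
  proof (rule tendsto_lowerbound[OF lim])
    have "eventually (\<lambda>h. h < real n - x) (at_right 0)" "eventually (\<lambda>h. h > 0) (at_right (0::real))"
      using n by (auto intro: eventually_at_right_less eventually_at_rightI[of 0 "real n - x"])
    then show "eventually (\<lambda>h. 1 / lam (Suc n) \<le> (phi (x + h) - phi x) / h) (at_right 0)"
    proof eventually_elim
      case (elim h)
      then show ?case using phi_slope_ge[of x "x + h" n] x by simp
    qed
  qed simp
  show "d \<le> 1 / lam (Suc n)" if n: "n \<ge> 1" "real (Suc n) \<le> x"
  proof (rule tendsto_upperbound[OF lim])
    show "eventually (\<lambda>h. (phi (x + h) - phi x) / h \<le> 1 / lam (Suc n)) (at_right 0)"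
      using eventually_at_right_less[of 0]
    proof eventually_elim
      case (elim h)
      then show ?case using phi_slope_le[of n x "x + h"] n by simp
    qed
  qed simp
qed

lemma phi_increment_asymp:
  assumes "\<xi> < 0"
  shows "(\<lambda>N. sqrt (2 * real N) * (phi (\<xi> + real N) - lam N)) \<longlonglongrightarrow> \<xi>"
proof -
  \<comment> \<open>Then \<xi> + N + K \<ge> N + 2, so the chord over [N + 1, N + 2] lies to the
    left of the interval for every \<open>N\<close>.\<close>
  obtain K :: nat where K: "2 - \<xi> \<le> real K" using real_arch_simple by blast
  define s where "s = (\<lambda>N. (phi (real (N + K)) - phi (\<xi> + real (N + K))) / (- \<xi>))"
  have lim: "(\<lambda>N. sqrt (2 * real (N + K)) * s N) \<longlonglongrightarrow> 1"
  proof (rule tendsto_sandwich)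
    have "1 / lam (Suc (N + K)) \<le> s N" for N
      using phi_slope_ge[of "\<xi> + real (N + K)" "real (N + K)" "N + K"] K assms by (simp add: s_def)
    then show "eventually (\<lambda>N. sqrt (2 * real (N + K)) / lam (N + Suc K) \<le> sqrt (2 * real (N + K)) * s N) sequentially"
      by (intro always_eventually allI) (simp add: mult_left_mono divide_inverse)
    have "s N \<le> 1 / lam (Suc (Suc N))" for N
      using phi_slope_le[of "Suc N" "\<xi> + real (N + K)" "real (N + K)"] K assms by (simp add: s_def)
    then show "eventually (\<lambda>N. sqrt (2 * real (N + K)) * s N \<le> sqrt (2 * real (N + K)) / lam (N + 2)) sequentially"
      by (intro always_eventually allI) (simp add: mult_left_mono divide_inverse)
  qed (rule sqrt_div_lam_shift_tendsto)+
  have "\<xi> * s N = phi (\<xi> + real (N + K)) - lam (N + K)" for N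
    using phi_of_nat[of "N + K"] K assms by (simp add: s_def)
  then have eq: "\<xi> * (sqrt (2 * real (N + K)) * s N) =
      sqrt (2 * real (N + K)) * (phi (\<xi> + real (N + K)) - lam (N + K))" for N
    by (simp only: mult.left_commute[of \<xi>])
  have "(\<lambda>N. sqrt (2 * real (N + K)) * (phi (\<xi> + real (N + K)) - lam (N + K))) \<longlonglongrightarrow> \<xi>"
    using tendsto_mult[OF tendsto_const lim, of \<xi>] by (simp only: eq mult_1_right)
  then show ?thesis by (rule LIMSEQ_offset[of _ K])
qed

lemma deriv_F_asymp:
  assumes "x \<le> 0"
  shows "(\<lambda>N. complex_of_real (sqrt (2 * real N)) * deriv F (of_real (x + real N))) \<longlonglongrightarrow> 1"
proof -
  obtain K :: nat where K: "2 - x \<le> real K" using real_arch_simple by blast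
  \<comment> \<open>For \<open>x = 0\<close> the chord on the right must start beyond N + K, at N +
    K + 1; hence the index \<open>N + (K + 2)\<close>.\<close>
  have "\<exists>d. deriv F (of_real (x + real (N + K))) = of_real d \<and> 1 / lam (N + (K + 2)) \<le> d \<and> d \<le> 1 / lam (N + 2)" for N
  proof -
    have pos: "x + real (N + K) > 0" using K by simp
    obtain d where d: "deriv F (of_real (x + real (N + K))) = of_real d"
      "(phi has_real_derivative d) (at (x + real (N + K)))" using deriv_F_of_real[OF pos] .
    have "1 / lam (Suc (Suc (N + K))) \<le> d" "d \<le> 1 / lam (Suc (Suc N))"
      using deriv_phi_bounds[OF d(2) pos] K assms by auto
    with d(1) show ?thesis by auto
  qed
  then obtain d where d: "\<And>N. deriv F (of_real (x + real (N + K))) = of_real (d N)"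
    "\<And>N. 1 / lam (N + (K + 2)) \<le> d N" "\<And>N. d N \<le> 1 / lam (N + 2)" by metis
  have "(\<lambda>N. sqrt (2 * real (N + K)) * d N) \<longlonglongrightarrow> 1"
  proof (rule tendsto_sandwich)
    show "eventually (\<lambda>N. sqrt (2 * real (N + K)) / lam (N + (K + 2)) \<le> sqrt (2 * real (N + K)) * d N) sequentially"
      using d(2) by (intro always_eventually allI) (simp add: mult_left_mono divide_inverse)
    show "eventually (\<lambda>N. sqrt (2 * real (N + K)) * d N \<le> sqrt (2 * real (N + K)) / lam (N + 2)) sequentially"
      using d(3) by (intro always_eventually allI) (simp add: mult_left_mono divide_inverse)
  qed (rule sqrt_div_lam_shift_tendsto)+
  then have "(\<lambda>N. complex_of_real (sqrt (2 * real (N + K)) * d N)) \<longlonglongrightarrow> of_real 1"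
    by (rule tendsto_of_real)
  then have "(\<lambda>N. complex_of_real (sqrt (2 * real (N + K))) * deriv F (of_real (x + real (N + K)))) \<longlonglongrightarrow> 1"
    by (simp only: d(1) of_real_mult of_real_1)
  then show ?thesis by (rule LIMSEQ_offset[of _ K])
qed

lemma deriv_F_shift:
  assumes "x > -1"
  shows "deriv F (of_real x) = deriv F (of_real (x + real n)) * of_real (\<Prod>l=1..n. 1 + 1 / (phi (x + real l))\<^sup>2)"
proof (induction n)
  case (Suc n)
  have "deriv F (of_real (x + real n)) =
      deriv F (of_real (x + real (Suc n))) * of_real (1 + 1 / (phi (x + real (Suc n)))\<^sup>2)"
    using deriv_F_step[of "x + real n"] assms by (simp add: add_ac)
  with Suc show ?case by (simp add: mult_ac del: of_nat_Suc)
qed simp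

text \<open>Going up \<open>N\<close> steps, \<open>F'\<close> is divided by the product and ends up at a point where it is
  asymptotically \<open>1 / sqrt (2 * N)\<close>.\<close>

lemma inverse_deriv_F_limit:
  assumes x: "x > -1" "x \<le> 0"
  shows "\<exists>L. (\<lambda>N. sqrt (2 * real N) * (\<Prod>l=1..N. inverse (1 + 1 / (phi (x + real l))\<^sup>2))) \<longlonglongrightarrow> L
    \<and> 1 / deriv F (of_real x) = of_real L"
proof -
  obtain d where d: "deriv F (of_real (x + 1)) = of_real d" "(phi has_real_derivative d) (at (x + 1))"
    using deriv_F_of_real[of "x + 1"] x by auto
  obtain n where n: "x + 1 < real n" using reals_Archimedean2 by blast
  have "1 / lam (Suc n) > 0" using lam_Suc_pos[of n] by simp
  then have d0: "d > 0" using deriv_phi_bounds(1)[OF d(2) _ n] x by linarith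
  \<comment> \<open>One step to the right lands on the positive axis, where the derivative of
    \<open>phi\<close> is positive. So \<open>D > 0\<close>, and division by it is
    legitimate.\<close>
  define D where "D = d * (1 + 1 / (phi (x + 1))\<^sup>2)"
  have D: "deriv F (of_real x) = of_real D"
    using deriv_F_step[of x] x d by (simp add: D_def)
  have D0: "D > 0" using d0 unfolding D_def by (intro mult_pos_pos add_pos_nonneg) auto
  define P where "P = (\<lambda>N. \<Prod>l=1..N. inverse (1 + 1 / (phi (x + real l))\<^sup>2))"
  have P: "deriv F (of_real (x + real N)) = of_real (D * P N)" for N
  proof -
    have Q: "(\<Prod>l=1..N. 1 + 1 / (phi (x + real l))\<^sup>2) * P N = 1"
      unfolding P_def prod.distrib[symmetric]
    proof (intro prod.neutral ballI right_inverse)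
      show "1 + 1 / (phi (x + real l))\<^sup>2 \<noteq> 0" for l
        by (metis add_nonneg_eq_0_iff zero_le_divide_1_iff zero_le_one zero_le_power2 zero_neq_one)
    qed
    have "complex_of_real (D * P N) = deriv F (of_real (x + real N)) *
        of_real ((\<Prod>l=1..N. 1 + 1 / (phi (x + real l))\<^sup>2) * P N)"
      using deriv_F_shift[OF x(1), of N] unfolding D of_real_mult by (simp only: mult.assoc)
    then show ?thesis by (simp only: Q of_real_1 mult_1_right)
  qed
  have "(\<lambda>N. complex_of_real (sqrt (2 * real N) * (D * P N))) \<longlonglongrightarrow> of_real 1"
    using deriv_F_asymp[OF x(2)] by (simp only: P of_real_mult of_real_1)
  then have "(\<lambda>N. sqrt (2 * real N) * (D * P N)) \<longlonglongrightarrow> 1"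
    by (simp only: tendsto_of_real_iff)
  then have "(\<lambda>N. sqrt (2 * real N) * (D * P N) / D) \<longlonglongrightarrow> 1 / D"
    using D0 by (intro tendsto_divide) auto
  then have "(\<lambda>N. sqrt (2 * real N) * P N) \<longlonglongrightarrow> 1 / D"
    using D0 by simp
  then show ?thesis
    unfolding P_def by (intro exI[of _ "1 / D"]) (simp add: D)
qed

section \<open>The limit formulas\<close>

lemma xi_limit:
  assumes p: "p \<ge> 1" and k: "k \<in> {1..2 ^ (p - 1)}"
  shows "(\<lambda>N. sqrt (2 * real N) *
      ((\<Sum>l=1..p. 1 / alpha l (rr k l)) + (\<Sum>l=1..N-p. 1 / lams (alpha p k) l) - lam N))
    \<longlonglongrightarrow> xi F p k"
proof -
  define y where "y = xi F p k + real p"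
  note xi = xi_characterization[OF p k]
  have y: "-1 < y" "y < 0" "Phi y = alpha p k" using xi by (auto simp: y_def)
  have "k \<le> 2 ^ (p - 1)" "(2::nat) ^ (p - 1) \<le> 2 ^ p" using k by (auto intro: power_increasing)
  then have "k \<le> 2 ^ p" by (rule order_trans)
  then have kp: "k \<ge> 1" "rr k p = k" using k by (auto intro: rr_id)
  \<comment> \<open>Since 1/z = z - psi z, each term is a difference of consecutive levels, starting
    from 0 at level 0.\<close>
  have "(\<Sum>l=1..j. 1 / alpha l (rr k l)) = alpha j (rr k j)" for j
  proof (induction j)
    case 0
    then show ?case using alpha_in_Yset[OF rr_ge_1[OF kp(1)], of 0] by (simp add: Yset_0)
  next
    case (Suc j)
    then show ?case using psi_alpha_rr[OF kp(1), of j] by (simp add: psi_def)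
  qed
  then have sum1: "(\<Sum>l=1..p. 1 / alpha l (rr k l)) = alpha p k" using kp by simp
  \<comment> \<open>The same telescoping to the right of \<open>y\<close>, starting from
    \<open>Phi y = alpha p k\<close>.\<close>
  have sum2: "(\<Sum>l=1..n. 1 / lams (alpha p k) l) = Phi (y + real n) - alpha p k" for n
  proof (induction n)
    case (Suc n)
    have "Phi (y + real n) = psi (Phi (y + real (Suc n)))"
      using Phi_eq_phi[of "y + real (Suc n)"] y by (simp add: Phi_def add_ac)
    then have "1 / lams (alpha p k) (Suc n) = Phi (y + real (Suc n)) - Phi (y + real n)"
      using lams_Phi[OF y(1), of "Suc n"] y(3) by (simp add: psi_def)
    then show ?case using Suc by simp
  qed (simp add: y)
  have ev: "eventually (\<lambda>N. sqrt (2 * real N) * (phi (xi F p k + real N) - lam N) =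
     sqrt (2 * real N) *
      ((\<Sum>l=1..p. 1 / alpha l (rr k l)) + (\<Sum>l=1..N-p. 1 / lams (alpha p k) l) - lam N)) sequentially"
    \<comment> \<open>For \<open>N > p\<close> the subtraction \<open>N - p\<close> is not truncated
      and \<open>y + real (N - p)\<close> is positive, where \<open>Phi\<close> and
      \<open>phi\<close> agree.\<close>
    using eventually_gt_at_top[of p]
  proof eventually_elim
    case (elim N)
    have "Phi (y + real (N - p)) = phi (y + real (N - p))"
      using elim y by (intro Phi_eq_phi) (simp add: of_nat_diff)
    moreover have "y + real (N - p) = xi F p k + real N"
      using elim by (simp add: y_def of_nat_diff)
    ultimately show ?case unfolding sum1 sum2 by simp
  qed
  show ?thesis
    by (rule Lim_transform_eventually[OF phi_increment_asymp ev]) (use xi in simp)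
qed

text \<open>Both factors start at y = \<xi> + p in ]-1, 0[: steps to the left give the finite
  product, steps to the right the limit.\<close>

lemma inverse_deriv_xi:
  assumes p: "p \<ge> 1" and k: "k \<in> {1..2 ^ (p - 1)}"
  shows "\<exists>L. (\<lambda>N. sqrt (2 * real N) * (\<Prod>l=1..N. inverse (1 + 1 / (lams (alpha p k) l)\<^sup>2))) \<longlonglongrightarrow> L
     \<and> 1 / deriv F (of_real (xi F p k)) =
        of_real ((\<Prod>l=1..p. inverse (1 + 1 / (alpha l (rr k l))\<^sup>2)) * L)"
proof -
  define y where "y = xi F p k + real p"
  note xi = xi_characterization[OF p k]
  have y: "-1 < y" "y < 0" "Phi y = alpha p k" using xi by (auto simp: y_def)
  have "k \<le> 2 ^ (p - 1)" "(2::nat) ^ (p - 1) \<le> 2 ^ p" using k by (auto intro: power_increasing)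
  then have "k \<le> 2 ^ p" by (rule order_trans)
  then have kp: "k \<ge> 1" "rr k p = k" "k \<in> {1..2^p}" using k by (auto intro: rr_id)
  have lams: "lams (alpha p k) l = phi (y + real l)" if "l \<ge> 1" for l
    using lams_Phi[OF y(1), of l] Phi_eq_phi[of "y + real l"] y that by simp
  obtain L where L: "(\<lambda>N. sqrt (2 * real N) * (\<Prod>l=1..N. inverse (1 + 1 / (phi (y + real l))\<^sup>2))) \<longlonglongrightarrow> L"
    "1 / deriv F (of_real y) = of_real L"
    using inverse_deriv_F_limit[of y] y by auto
  have iter: "(psi ^^ i) (Phi y) = alpha (p - i) (rr k (p - i))" if "i \<le> p" for i
    using funpow_psi_alpha[OF kp(1) that] kp y by simp
  have "Phi y \<in> Yset p" using alpha_in_Yset[OF kp(3)] y by simp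
  then have "deriv F (of_real (y - real p)) =
      deriv F (of_real y) * of_real (\<Prod>i<p. 1 + 1 / ((psi ^^ i) (Phi y))\<^sup>2)"
    using orbit[OF y(1), of p] by (simp add: Yset_def)
  \<comment> \<open>The \<open>i\<close>-th iterate sits at level \<open>p - i\<close>, so the
    product is reversed.\<close>
  also have "(\<Prod>i<p. 1 + 1 / ((psi ^^ i) (Phi y))\<^sup>2) = (\<Prod>l=1..p. 1 + 1 / (alpha l (rr k l))\<^sup>2)"
    by (rule prod.reindex_bij_witness[of _ "\<lambda>l. p - l" "\<lambda>i. p - i"]) (auto simp: iter)
  finally have "1 / deriv F (of_real (xi F p k)) =
     of_real (inverse (\<Prod>l=1..p. 1 + 1 / (alpha l (rr k l))\<^sup>2)) * (1 / deriv F (of_real y))"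
    by (simp add: y_def divide_inverse)
  also have "\<dots> = of_real ((\<Prod>l=1..p. inverse (1 + 1 / (alpha l (rr k l))\<^sup>2)) * L)"
    unfolding L(2) by (simp only: of_real_mult prod_inversef[symmetric] o_def)
  finally have "1 / deriv F (of_real (xi F p k)) =
     of_real ((\<Prod>l=1..p. inverse (1 + 1 / (alpha l (rr k l))\<^sup>2)) * L)" .
  moreover have "(\<Prod>l=1..N. inverse (1 + 1 / (lams (alpha p k) l)\<^sup>2)) =
      (\<Prod>l=1..N. inverse (1 + 1 / (phi (y + real l))\<^sup>2))" for N
    by (intro prod.cong) (auto simp: lams)
  ultimately show ?thesis using L(1) by auto
qed

lemma inverse_deriv_0:
  "\<exists>L. (\<lambda>N. sqrt (2 * real N) * (\<Prod>l=1..N. inverse (1 + 1 / (lam l)\<^sup>2))) \<longlonglongrightarrow> L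
     \<and> 1 / deriv F 0 = of_real L"
proof -
  have "(\<Prod>l=1..N. inverse (1 + 1 / (lam l)\<^sup>2)) = (\<Prod>l=1..N. inverse (1 + 1 / (phi (0 + real l))\<^sup>2))" for N
    by (intro prod.cong) (auto simp: phi_of_nat)
  then show ?thesis using inverse_deriv_F_limit[of 0] by simp
qed

end

theorem theorem3p8:
  fixes M :: "real measure" and F :: "complex \<Rightarrow> complex"
  assumes "prob_space M"
    and "sets M = sets borel"
    and "AE t in M. t \<in> {0..1}"
    and "\<And>n. (\<integral>t. t ^ n \<partial>M) = mseq n"
    and "F nicely_meromorphic_on UNIV"
    and "\<And>z. Re z > 0 \<Longrightarrow> F z = (\<integral>t. kern z t \<partial>M)"
  shows "(\<forall>p\<ge>1. \<forall>k\<in>{1..2^(p-1)}.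
            ((\<lambda>N. sqrt (2 * real N) *
                 ((\<Sum>l=1..p. 1 / alpha l (rr k l))
                  + (\<Sum>l=1..N-p. 1 / lams (alpha p k) l) - lam N))
               \<longlonglongrightarrow> xi F p k)
          \<and> (\<exists>L. (\<lambda>N. sqrt (2 * real N) * (\<Prod>l=1..N. inverse (1 + 1 / (lams (alpha p k) l)^2)))
                      \<longlonglongrightarrow> L
                 \<and> 1 / deriv F (complex_of_real (xi F p k))
                    = complex_of_real ((\<Prod>l=1..p. inverse (1 + 1 / (alpha l (rr k l))^2)) * L)))
         \<and> (\<exists>L. (\<lambda>N. sqrt (2 * real N) * (\<Prod>l=1..N. inverse (1 + 1 / (lam l)^2))) \<longlonglongrightarrow> L
                \<and> 1 / deriv F 0 = complex_of_real L)"
proof -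
  interpret prob_space M by fact
  interpret fixed_point_extension M F
    by unfold_locales (use assms in auto)
  show ?thesis using xi_limit inverse_deriv_xi inverse_deriv_0 by blast
qed

end
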